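(* Let $A$ be a finite set, let $E\subset A$ have at least two elements, let $\rho$ be a probability measure on $E$ with $H(\rho)>0$, and let $\delta>0$. There exists a measurable map $\phi:A^{\mathbb{N}}\to\{0,1\}^{\mathbb{N}}$ such that the following holds. If $(p_n)_{n\in\mathbb{N}}$ is a sequence of probability measures on $A$ all having the same conditional probability $\rho$ on $E$, with $p_n(E)\ge\delta>0$ for all $n\in\mathbb{N}$, and the associated one-sided Bernoulli shift $(A^{\mathbb{N}},\mathcal{B},\bigotimes_{n\in\mathbb{N}}p_n)$ is nonsingular, then $\phi$ is a measure-preserving factor from this nonsingular system to an i.i.d. system taking two values $\{0,1\}$, i.e. to $(\{0,1\}^{\mathbb{N}},\mathcal{B},\bigotimes_{n\in\mathbb{N}}\alpha)$ with the left-shift, for some probability measure $\alpha$ on $\{0,1\}$ giving positive mass to both $0$ and $1$.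
   Context: $\mathbb{N}=\{0,1,2,\dots\}$. $H(\rho)=-\sum_{c}\rho(c)\log\rho(c)$ is Shannon entropy. For a probability measure $\beta$ on $A$ with $\beta(E)>0$, the conditional measure of $\beta$ on $E$ is $B\mapsto\beta(B\cap E)/\beta(E)$. A one-sided Bernoulli shift is a product space $(A^{\mathbb{N}},\mathcal{B},\bigotimes_{n\in\mathbb{N}}p_n)$ with the left-shift $(Ta)_i=a_{i+1}$; it is nonsingular if $\mu\circ T^{-1}$ is equivalent to $\mu$ (same null sets), where $\mu=\bigotimes_n p_n$. A measurable map $\phi:\Omega\to\Omega'$ between systems $(\Omega,\mathcal{F},\mu,T)$ and $(\Omega',\mathcal{F}',\mu',T')$ is a measure-preserving factor if $\phi\circ T=T'\circ\phi$ and $\mu\circ\phi^{-1}=\mu'$. *)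

theory Defs
  imports "HOL-Probability.Probability"
begin

text \<open>
  The alphabet is a type of class \<open>finite\<close>, and a probability measure on it is a \<open>pmf\<close>.
  The two-letter alphabet $\{0,1\}$ is \<open>bool\<close>, with \<open>False\<close> for 0 and \<open>True\<close> for 1.
\<close>

definition shannon_entropy :: "'a::finite pmf \<Rightarrow> real" where
  "shannon_entropy \<rho> = - (\<Sum>c\<in>UNIV. pmf \<rho> c * ln (pmf \<rho> c))"

text \<open>Only the product sigma-algebra of this measure is used.\<close>

definition seq_space :: "(nat \<Rightarrow> 'a) measure" where
  "seq_space = (\<Pi>\<^sub>M n\<in>UNIV. count_space UNIV)"

definition bernoulli_measure :: "(nat \<Rightarrow> 'a pmf) \<Rightarrow> (nat \<Rightarrow> 'a) measure" where
  "bernoulli_measure p = (\<Pi>\<^sub>M n\<in>UNIV. measure_pmf (p n))"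

definition left_shift :: "(nat \<Rightarrow> 'a) \<Rightarrow> (nat \<Rightarrow> 'a)" where
  "left_shift a = (\<lambda>i. a (Suc i))"

definition nonsingular :: "'x measure \<Rightarrow> ('x \<Rightarrow> 'x) \<Rightarrow> bool" where
  "nonsingular M T \<longleftrightarrow> T \<in> M \<rightarrow>\<^sub>M M \<and> null_sets (distr M M T) = null_sets M"

definition measure_preserving_factor ::
  "('x \<Rightarrow> 'y) \<Rightarrow> 'x measure \<Rightarrow> ('x \<Rightarrow> 'x) \<Rightarrow> 'y measure \<Rightarrow> ('y \<Rightarrow> 'y) \<Rightarrow> bool" where
  "measure_preserving_factor \<phi> M T N S \<longleftrightarrow>
     \<phi> \<in> M \<rightarrow>\<^sub>M N \<and> (\<forall>x\<in>space M. \<phi> (T x) = S (\<phi> x)) \<and> distr M N \<phi> = N"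

end

theory Submission
  imports Defs "HOL-Library.Sublist" "HOL-Real_Asymp.Real_Asymp"
begin

text \<open>
  Fix a letter \<open>c\<close> with $0 < q = \rho(c) < 1$. Seen through the map that forgets everything except
  whether a letter lies in \<open>E\<close> and whether it is \<open>c\<close>, the sequence consists of gaps (whose laws vary)
  and independent coins of bias \<open>q\<close>, at a density at least $\delta$.

  The letters are processed from right to left by a machine with two stacks, one of unread coins and
  one of output bits; every time step pops one output bit. A counter, driven only by coins that are
  never put on the stack, alternates between idling and storing \<open>M\<close> coins. At the end of each
  idle period a code reads a variable number of stored coins and pushes \<open>L\<close> output bits, which
  are exactly i.i.d. of a small bias \<open>\<alpha>\<close>. As the counter is independent of the stored coins and each coin
  is read once, the output bits are independent. Stacks make the machine local: what it does above
  a given level does not depend on the content below, so that once the counter has been synchronised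
  by \<open>M\<close> consecutive tails, the output at a position is determined by a finite window to its right, and the
  limit over growing windows is an equivariant map depending on the future only.

  If the code reads on average fewer than \<open>M\<close> coins and \<open>L\<close> is large compared with $M/\delta$, both stacks
  drift upwards and the output is almost surely determined. The laws of the truncated outputs are
  only shown to be dominated by the i.i.d. law; equality follows in the limit because both have mass 1.

  A code of this kind: partition \<open>2J\<^sup>2\<close> coins into \<open>J\<close> blocks and output \<open>True\<close> for a block that equals the
  special word $T^J F^J$. This reads far too many coins, but the words containing a special block can
  be permuted, without changing the number of heads, so that they all start with $T^r$. Thus reading
  can stop with the answer $F^J$ at the first tail among the first \<open>r\<close> coins.
\<close>

section \<open>Coin words and expectations over finite windows\<close>

definition pr :: "real \<Rightarrow> bool list \<Rightarrow> real" where
  "pr b w = (\<Prod>x\<leftarrow>w. if x then b else 1 - b)"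

lemma pr_simps [simp]:
  "pr b [] = 1" "pr b (x # w) = (if x then b else 1 - b) * pr b w"
  by (auto simp: pr_def)

lemma pr_append [simp]: "pr b (v @ w) = pr b v * pr b w"
  by (induction v) auto

lemma pr_replicate [simp]: "pr b (replicate n x) = (if x then b else 1 - b) ^ n"
  by (induction n) auto

lemma pr_nonneg: "0 \<le> b \<Longrightarrow> b \<le> 1 \<Longrightarrow> 0 \<le> pr b w"
  by (induction w) auto

lemma lists_Suc: "{xs :: 'a list. length xs = Suc n} = (\<lambda>(x, xs). x # xs) ` (UNIV \<times> {xs. length xs = n})"
  by (auto simp: length_Suc_conv image_iff)

lemma finite_lists_len [simp]: "finite {xs :: 'a::finite list. length xs = n}"
  using finite_lists_length_eq[of "UNIV :: 'a set" n] by simp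

lemma sum_lists_Suc:
  fixes f :: "'a::finite list \<Rightarrow> real"
  shows "(\<Sum>xs | length xs = Suc n. f xs) = (\<Sum>x\<in>UNIV. \<Sum>xs | length xs = n. f (x # xs))"
proof -
  have "(\<Sum>xs | length xs = Suc n. f xs) = (\<Sum>(x, xs)\<in>UNIV \<times> {xs. length xs = n}. f (x # xs))"
    unfolding lists_Suc by (subst sum.reindex) (auto simp: inj_on_def case_prod_unfold)
  then show ?thesis
    by (simp add: sum.cartesian_product)
qed

lemma sum_lists_append:
  fixes f :: "'a::finite list \<Rightarrow> real"
  shows "(\<Sum>w | length w = m + n. f w) = (\<Sum>u | length u = m. \<Sum>v | length v = n. f (u @ v))"
proof (induction m arbitrary: f)
  case 0
  have "{u :: 'a list. length u = 0} = {[]}"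
    by auto
  then show ?case by simp
next
  case (Suc m)
  show ?case
    by (simp add: sum_lists_Suc Suc)
qed

lemma sum_pr: "(\<Sum>w | length w = n. pr b w) = 1"
  by (induction n) (simp_all add: sum_lists_Suc UNIV_bool flip: sum_distrib_left)

lemma sum_pr_prefix:
  assumes "length v \<le> n"
  shows "(\<Sum>w | length w = n \<and> prefix v w. pr b w) = pr b v"
proof -
  have "{w. length w = n \<and> prefix v w} = (@) v ` {w. length w = n - length v}"
    using assms by (auto simp: prefix_def image_iff)
  then have "(\<Sum>w | length w = n \<and> prefix v w. pr b w) = (\<Sum>w | length w = n - length v. pr b (v @ w))"
    by (simp add: sum.reindex inj_on_def)
  then show ?thesis
    by (simp add: sum_pr flip: sum_distrib_left)
qed

text \<open>Independent letters with laws \<open>P i\<close>, peeled off from the left: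
  \<open>run\<close> processes the leftmost letter last, so one recursion step averages over one
  step of the machine.\<close>

primrec expect :: "nat \<Rightarrow> (nat \<Rightarrow> 't::finite pmf) \<Rightarrow> ('t list \<Rightarrow> real) \<Rightarrow> real" where
  "expect 0 P F = F []"
| "expect (Suc n) P F = (\<Sum>t\<in>UNIV. pmf (P 0) t * expect n (\<lambda>i. P (Suc i)) (\<lambda>ts. F (t # ts)))"

lemma expect_mono: "(\<And>ts. length ts = n \<Longrightarrow> F ts \<le> G ts) \<Longrightarrow> expect n P F \<le> expect n P G"
  by (induction n arbitrary: P F G) (auto intro!: sum_mono mult_left_mono)

lemma expect_cong: "(\<And>ts. length ts = n \<Longrightarrow> F ts = G ts) \<Longrightarrow> expect n P F = expect n P G"
  by (intro antisym expect_mono) auto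

lemma expect_cmult: "expect n P (\<lambda>ts. c * F ts) = c * expect n P F"
  by (induction n arbitrary: P F) (auto simp: sum_distrib_left intro!: sum.cong)

lemma expect_add: "expect n P (\<lambda>ts. F ts + G ts) = expect n P F + expect n P G"
  by (induction n arbitrary: P F G) (auto simp: sum.distrib distrib_left)

lemma expect_zero [simp]: "expect n P (\<lambda>ts. 0) = 0"
  using expect_cmult[of n P 0 "\<lambda>_. 0"] by simp

lemma expect_one [simp]: "expect n P (\<lambda>ts. 1) = 1"
  by (induction n arbitrary: P) (auto simp: sum_pmf_eq_1)

lemma expect_sum: "finite I \<Longrightarrow> expect n P (\<lambda>ts. \<Sum>i\<in>I. F i ts) = (\<Sum>i\<in>I. expect n P (F i))"
  by (induction I rule: finite_induct) (auto simp: expect_add)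

lemma expect_nonneg: "(\<And>ts. 0 \<le> F ts) \<Longrightarrow> 0 \<le> expect n P F"
  using expect_mono[of n "\<lambda>_. 0" F P] by simp

lemma expect_eq_sum:
  "expect n P F = (\<Sum>ts | length ts = n. (\<Prod>i<n. pmf (P i) (ts ! i)) * F ts)"
proof (induction n arbitrary: P F)
  case (Suc n)
  show ?case
    by (simp add: Suc sum_lists_Suc sum_distrib_left prod.lessThan_Suc_shift mult.assoc del: prod.lessThan_Suc)
qed simp

text \<open>Provides a common geometric rate. The strict gap \<open>a < \<mu>\<close> keeps
  constants such as \<open>D / (\<mu> - a)\<close> finite; forcing terms of rate \<open>b\<close>
  are absorbed by \<open>b \<le> \<mu>\<close>.\<close>

lemma geometric_gap:
  fixes a b :: real
  assumes "a < 1" "b < 1"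
  obtains \<mu> where "0 < \<mu>" "\<mu> < 1" "a < \<mu>" "b \<le> \<mu>"
  using that[of "(max 0 (max a b) + 1) / 2"] assms by (auto simp: max_def field_simps)

section \<open>The stack machine\<close>

text \<open>The control counter, the stack of unread coins and the stack of output bits.\<close>

type_synonym state = "nat \<times> bool list \<times> bool list"

abbreviation "ctl \<sigma> \<equiv> fst \<sigma>"
abbreviation "coins \<sigma> \<equiv> fst (snd \<sigma>)"
abbreviation "outs \<sigma> \<equiv> snd (snd \<sigma>)"

text \<open>Leaves are the coin words at which reading stops. A read costs at most \<open>r\<close>
  coins, or exceptionally \<open>T\<close>, the latter only after \<open>r\<close> heads.
  \<open>dec_law\<close> is an upper bound, which is the form that the domination argument
  propagates.\<close>

locale stack_coding =
  fixes q \<alpha> :: real and r L M T :: nat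
    and leaves :: "bool list set" and dec :: "bool list \<Rightarrow> bool list"
  assumes q: "0 < q" "q < 1" and \<alpha>: "0 \<le> \<alpha>" "\<alpha> \<le> 1" and M: "0 < M" and r_le_T: "r \<le> T"
    and finite_leaves: "finite leaves"
    and length_dec: "\<And>l. l \<in> leaves \<Longrightarrow> length (dec l) = L"
    and dec_law: "\<And>v. length v = L \<Longrightarrow> (\<Sum>l | l \<in> leaves \<and> dec l = v. pr q l) \<le> pr \<alpha> v"
    and leaf_cases: "\<And>l. l \<in> leaves \<Longrightarrow> length l \<le> r \<or> length l = T \<and> prefix (replicate r True) l"
    and long_leaves: "(\<Sum>l | l \<in> leaves \<and> r < length l. pr q l) \<le> q ^ r"
    and leaf_short: "\<And>U. r \<le> length U \<Longrightarrow> \<not> prefix (replicate r True) U \<Longrightarrow> \<exists>l\<in>leaves. prefix l U"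
    and leaf_long: "\<And>U. T \<le> length U \<Longrightarrow> \<exists>l\<in>leaves. prefix l U"
begin

section \<open>Reading a leaf off the coin stack\<close>

primrec read_leaf :: "bool list \<Rightarrow> bool list \<Rightarrow> (bool list \<times> bool list) option" where
  "read_leaf [] w = (if w \<in> leaves then Some (w, []) else None)"
| "read_leaf (u # U) w = (if w \<in> leaves then Some (w, u # U) else read_leaf U (w @ [u]))"

lemma read_leaf_SomeD: "read_leaf U w = Some (l, U') \<Longrightarrow> l \<in> leaves \<and> w @ U = l @ U'"
proof (induction U arbitrary: w)
  case (Cons u U)
  then show ?case
    using Cons.IH[of "w @ [u]"] by (auto split: if_splits)
qed (auto split: if_splits)

lemma read_leaf_append: "read_leaf U w = Some (l, U') \<Longrightarrow> read_leaf (U @ X) w = Some (l, U' @ X)"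
proof (induction U arbitrary: w)
  case Nil
  then show ?case by (cases X) (auto split: if_splits)
qed (auto split: if_splits)

lemma read_leaf_NoneD: "read_leaf U w = None \<Longrightarrow> prefix v U \<Longrightarrow> w @ v \<notin> leaves"
proof (induction U arbitrary: w v)
  case (Cons u U)
  show ?case
    using Cons.prems Cons.IH[of "w @ [u]" "tl v"] by (cases v) (auto split: if_splits)
qed (auto split: if_splits)

text \<open>
  If the stack does not hold enough coins, the bits to be pushed are unknown; then both stacks are
  emptied, since everything below the unknown bits is out of reach.
\<close>

definition decode :: "bool list \<Rightarrow> bool list \<Rightarrow> bool list \<times> bool list" where
  "decode U B = (case read_leaf U [] of None \<Rightarrow> ([], []) | Some (l, U') \<Rightarrow> (U', dec l @ B))"

text \<open>
  The counter value \<open>0\<close> means idle, a value \<open>k\<close> with \<open>0 < k \<le> M\<close> that \<open>k\<close> more coins will be stored, and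
  \<open>M + i\<close> that the true counter value is unknown but \<open>i\<close> more tails would force it to be \<open>0\<close>.
\<close>

fun core :: "bool option \<Rightarrow> state \<Rightarrow> state" where
  "core None \<sigma> = \<sigma>"
| "core (Some s) (k, U, B) =
    (if k = 0 then if s then (M, decode U B) else (0, U, B)
     else if k \<le> M then (k - 1, s # U, B)
     else (if s then 2 * M else if k = Suc M then 0 else k - 1, U, B))"

definition pop :: "state \<Rightarrow> state" where
  "pop \<sigma> = (ctl \<sigma>, coins \<sigma>, tl (outs \<sigma>))"

primrec run :: "bool option list \<Rightarrow> state" where
  "run [] = (2 * M, [], [])"
| "run (t # ts) = core t (pop (run ts))"

text \<open>The second state is possible for a larger window when the first one was computed from a smaller one.\<close>

fun rel :: "state \<Rightarrow> state \<Rightarrow> bool" where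
  "rel (k, U, B) (k', U', B') \<longleftrightarrow>
    (if k \<le> M then k' = k \<and> prefix U U' \<and> prefix B B'
     else U = [] \<and> B = [] \<and> k \<le> 2 * M \<and> (k' \<le> k - M \<or> M < k' \<and> k' \<le> k))"

section \<open>Stability of the machine under enlarging the window\<close>

lemma prefix_tl: "prefix xs ys \<Longrightarrow> prefix (tl xs) (tl ys)"
  by (auto simp: prefix_def tl_append split: list.split)

lemma decode_mono:
  "prefix U U' \<Longrightarrow> prefix B B' \<Longrightarrow>
    prefix (fst (decode U B)) (fst (decode U' B')) \<and> prefix (snd (decode U B)) (snd (decode U' B'))"
  by (auto simp: decode_def read_leaf_append elim!: prefixE split: option.splits)

lemma rel_pop: "rel \<sigma> \<tau> \<Longrightarrow> rel (pop \<sigma>) (pop \<tau>)"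
  by (cases \<sigma>; cases \<tau>) (auto simp: pop_def prefix_tl split: if_splits)

text \<open>While unsynchronised, a tail lowers \<open>k - M\<close> and every positive candidate
  \<open>k'\<close>, so at \<open>k = Suc M\<close> all candidates reach 0 together. A head resets
  to \<open>2 * M\<close>, which is compatible with every counter. Once synchronised, both states
  take the same branch and \<open>decode_mono\<close> handles the stacks.\<close>

lemma rel_core:
  assumes "rel \<sigma> \<tau>"
  shows "rel (core t \<sigma>) (core t \<tau>)"
proof -
  obtain k U B k' U' B' where [simp]: "\<sigma> = (k, U, B)" "\<tau> = (k', U', B')"
    by (metis prod.collapse)
  show ?thesis
  proof (cases t)
    case None
    then show ?thesis using assms by simp
  next
    case [simp]: (Some s)
    show ?thesis
    proof (cases "k \<le> M")
      case True
      then have r: "k' = k" "prefix U U'" "prefix B B'"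
        using assms by auto
      from decode_mono[OF r(2,3)] show ?thesis
        using True r by (cases "decode U B"; cases "decode U' B'") auto
    next
      case False
      then have r: "U = []" "B = []" "k \<le> 2 * M" "k' \<le> k - M \<or> M < k' \<and> k' \<le> k"
        using assms by auto
      show ?thesis
        using False r M by (cases "decode U' B'") auto
    qed
  qed
qed

lemma ctl_core_le: "ctl \<sigma> \<le> 2 * M \<Longrightarrow> ctl (core t \<sigma>) \<le> 2 * M"
  by (cases \<sigma>; cases t) auto

lemma ctl_run_le: "ctl (run ts) \<le> 2 * M"
  by (induction ts) (auto simp: pop_def ctl_core_le)

lemma unsync_empty: "M < ctl (run ts) \<Longrightarrow> coins (run ts) = [] \<and> outs (run ts) = []"
proof (induction ts)
  case (Cons t ts)
  then show ?case
    by (cases "run ts"; cases t) (auto simp: pop_def split: if_splits)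
qed simp

text \<open>The empty window starts at \<open>2 * M\<close>, where nothing is known, so it is
  related to every reachable state; afterwards both runs process the same letters
  \<open>ts\<close>.\<close>

lemma rel_run: "rel (run ts) (run (ts @ xs))"
proof (induction ts)
  case Nil
  show ?case
    using ctl_run_le[of xs] M by (cases "run xs") auto
qed (simp add: rel_core rel_pop)

lemma outs_mono:
  assumes "outs (run ts) \<noteq> []"
  shows "outs (run (ts @ xs)) \<noteq> []" "hd (outs (run (ts @ xs))) = hd (outs (run ts))"
  using rel_run[of ts xs] assms
  by (cases "run ts"; cases "run (ts @ xs)"; auto simp: prefix_def split: if_splits)+

section \<open>The autonomous dynamics of the counter\<close>

definition nxt :: "bool \<Rightarrow> nat \<Rightarrow> nat" where
  "nxt s k = (if k = 0 then if s then M else 0 else if k \<le> M then k - 1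
     else if s then 2 * M else if k = Suc M then 0 else k - 1)"

lemma nxt_le: "k \<le> 2 * M \<Longrightarrow> nxt s k \<le> 2 * M"
  by (auto simp: nxt_def)

text \<open>The counter never looks at the stacks, and \<open>nxt\<close> ignores the coin whenever
  that coin is stored. This is the source of the independence of counter and stored coins.\<close>

lemma ctl_core: "ctl (core (Some s) \<sigma>) = nxt s (ctl \<sigma>)"
  by (cases \<sigma>) (auto simp: nxt_def)

text \<open>Forward equation of the counter when a coin arrives with probability \<open>e\<close>.
  It is also applied to sub-probabilities: restricted to the emission of \<open>bs\<close>, the mass
  is \<open>pr \<alpha> bs\<close>.\<close>

definition advance :: "real \<Rightarrow> (nat \<Rightarrow> real) \<Rightarrow> nat \<Rightarrow> real" where
  "advance e c k' = (1 - e) * c k' +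
     e * (\<Sum>k\<le>2 * M. c k * (q * of_bool (nxt True k = k') + (1 - q) * of_bool (nxt False k = k')))"

lemma advance_nonneg: "0 \<le> e \<Longrightarrow> e \<le> 1 \<Longrightarrow> (\<And>k. 0 \<le> c k) \<Longrightarrow> 0 \<le> advance e c k"
  unfolding advance_def using q by (intro add_nonneg_nonneg mult_nonneg_nonneg sum_nonneg) auto

lemma sum_advance: "(\<Sum>k\<le>2 * M. advance e c k) = (\<Sum>k\<le>2 * M. c k)"
proof -
  have *: "(\<Sum>k'\<le>2 * M. of_bool (nxt s k = k') :: real) = 1" if "k \<le> 2 * M" for k s
    using nxt_le[OF that, of s] by (simp add: of_bool_def)
  have "(\<Sum>k'\<le>2 * M. \<Sum>k\<le>2 * M. c k * (q * of_bool (nxt True k = k') + (1 - q) * of_bool (nxt False k = k')))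
      = (\<Sum>k\<le>2 * M. \<Sum>k'\<le>2 * M. c k * (q * of_bool (nxt True k = k') + (1 - q) * of_bool (nxt False k = k')))"
    by (rule sum.swap)
  also have "\<dots> = (\<Sum>k\<le>2 * M. c k)"
  proof (intro sum.cong refl)
    fix k assume "k \<in> {..2 * M}"
    then have k: "k \<le> 2 * M" by simp
    have "(\<Sum>k'\<le>2 * M. c k * (q * of_bool (nxt True k = k') + (1 - q) * of_bool (nxt False k = k'))) =
      c k * (q * (\<Sum>k'\<le>2 * M. of_bool (nxt True k = k')) + (1 - q) * (\<Sum>k'\<le>2 * M. of_bool (nxt False k = k')))"
      by (simp only: sum.distrib flip: sum_distrib_left)
    then show "(\<Sum>k'\<le>2 * M. c k * (q * of_bool (nxt True k = k') + (1 - q) * of_bool (nxt False k = k'))) = c k"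
      by (simp only: *[OF k]) simp
  qed
  finally have "(\<Sum>k\<le>2 * M. advance e c k) = (1 - e) * (\<Sum>k\<le>2 * M. c k) + e * (\<Sum>k\<le>2 * M. c k)"
    unfolding advance_def by (simp only: sum.distrib flip: sum_distrib_left)
  then show ?thesis
    by (simp add: algebra_simps)
qed

definition coin_law :: "bool option pmf \<Rightarrow> bool" where
  "coin_law t \<longleftrightarrow> pmf t (Some True) = (1 - pmf t None) * q \<and> pmf t (Some False) = (1 - pmf t None) * (1 - q)"

lemma expect_Suc_coin:
  assumes "coin_law (P 0)" and e: "e = 1 - pmf (P 0) None"
  shows "expect (Suc n) P F = (1 - e) * expect n (\<lambda>i. P (Suc i)) (\<lambda>ts. F (None # ts)) +
    e * (q * expect n (\<lambda>i. P (Suc i)) (\<lambda>ts. F (Some True # ts)) +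
      (1 - q) * expect n (\<lambda>i. P (Suc i)) (\<lambda>ts. F (Some False # ts)))"
proof -
  have "pmf (P 0) (Some True) = e * q" "pmf (P 0) (Some False) = e * (1 - q)" "pmf (P 0) None = 1 - e"
    using assms by (auto simp: coin_law_def)
  moreover have "(\<Sum>t\<in>UNIV. g t) = g None + (g (Some True) + g (Some False))" for g :: "bool option \<Rightarrow> real"
    by (simp add: UNIV_option_conv UNIV_bool)
  ultimately show ?thesis
    by (simp only: expect.simps) (simp add: algebra_simps)
qed

section \<open>Domination of stacks and outputs by i.i.d. laws\<close>

definition matches :: "nat \<Rightarrow> bool list \<Rightarrow> bool list \<Rightarrow> state \<Rightarrow> bool" where
  "matches k y v \<sigma> \<longleftrightarrow> ctl \<sigma> = k \<and> prefix y (coins \<sigma>) \<and> prefix v (outs \<sigma>)"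

text \<open>
  Given the history \<open>H\<close> and the counter, the law of the stack contents is bounded by the i.i.d. law.
  In an infinite window this would be an equality; the bound survives truncation.
\<close>

definition dominated ::
  "(bool option list \<Rightarrow> state) \<Rightarrow> nat \<Rightarrow> (nat \<Rightarrow> bool option pmf) \<Rightarrow> (bool option list \<Rightarrow> bool) \<Rightarrow> (nat \<Rightarrow> real) \<Rightarrow> bool" where
  "dominated f n P H c \<longleftrightarrow>
    (\<forall>k y v. expect n P (\<lambda>ts. of_bool (H ts \<and> matches k y v (f ts))) \<le> c k * pr q y * pr \<alpha> v)"

lemma dominatedD:
  "dominated f n P H c \<Longrightarrow> expect n P (\<lambda>ts. of_bool (H ts \<and> matches k y v (f ts))) \<le> c k * pr q y * pr \<alpha> v"
  by (simp add: dominated_def)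

text \<open>The leaves are grouped by the full word of length \<open>L\<close> they decode to, and
  \<open>dec_law\<close> is applied to each extension of \<open>v\<close>.\<close>

lemma dec_law_prefix:
  assumes "length v \<le> L"
  shows "(\<Sum>l | l \<in> leaves \<and> prefix v (dec l). pr q l) \<le> pr \<alpha> v"
proof -
  let ?W = "{w. length w = L \<and> prefix v w}"
  have fW: "finite ?W"
    by (rule finite_subset[of _ "{w. length w = L}"]) auto
  have "(\<Sum>l | l \<in> leaves \<and> prefix v (dec l). pr q l) =
      (\<Sum>w\<in>?W. \<Sum>l | l \<in> {l \<in> leaves. prefix v (dec l)} \<and> dec l = w. pr q l)"
    by (rule sum.group[symmetric]) (auto simp: fW finite_leaves length_dec)
  also have "\<dots> \<le> (\<Sum>w\<in>?W. pr \<alpha> w)"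
  proof (rule sum_mono)
    fix w assume w: "w \<in> ?W"
    then have "{l \<in> {l \<in> leaves. prefix v (dec l)}. dec l = w} = {l. l \<in> leaves \<and> dec l = w}"
      by auto
    then show "(\<Sum>l | l \<in> {l \<in> leaves. prefix v (dec l)} \<and> dec l = w. pr q l) \<le> pr \<alpha> w"
      using dec_law[of w] w by simp
  qed
  also have "\<dots> = pr \<alpha> v"
    by (rule sum_pr_prefix[OF assms])
  finally show ?thesis .
qed

text \<open>Storing puts an independent coin on top. A read removes a leaf \<open>l\<close>, of
  weight \<open>pr q l\<close> whatever lies below, and pushes bits of law at most
  \<open>pr \<alpha>\<close>; the coins and bits underneath keep their product bound.
  \<open>H (tl ts)\<close> speaks of the letters processed before the new one.\<close>

lemma dominated_core:
  assumes coin: "coin_law (P 0)" and c: "\<And>k. 0 \<le> c k"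
    and dom: "dominated (\<lambda>ts. pop (run ts)) n (\<lambda>i. P (Suc i)) H c"
  shows "dominated run (Suc n) P (\<lambda>ts. H (tl ts)) (advance (1 - pmf (P 0) None) c)"
  unfolding dominated_def
proof (intro allI)
  fix k' y v
  define P' where "P' = (\<lambda>i. P (Suc i))"
  define e where "e = 1 - pmf (P 0) None"
  have e: "0 \<le> e" "e \<le> 1"
    by (auto simp: e_def pmf_le_1)
  define X where "X k y v = expect n P' (\<lambda>ts. of_bool (H ts \<and> matches k y v (pop (run ts))))" for k y v
  have X: "X k y v \<le> c k * pr q y * pr \<alpha> v" for k y v
    using dominatedD[OF dom] by (simp add: X_def P'_def)
  have X0: "0 \<le> X k y v" for k y v
    unfolding X_def by (rule expect_nonneg) simp
  \<comment> \<open>Contribution of the predecessor counter \<open>k\<close> when the new letter is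
    the coin \<open>s\<close>.\<close>
  define Y where "Y s k = expect n P' (\<lambda>ts. of_bool (H ts \<and> ctl (run ts) = k \<and>
    matches k' y v (core (Some s) (pop (run ts)))))" for s k
  have Y_sum: "expect n P' (\<lambda>ts. of_bool (H ts \<and> matches k' y v (run (Some s # ts)))) = (\<Sum>k\<le>2 * M. Y s k)" for s
    unfolding Y_def by (subst expect_sum[symmetric]) (auto intro!: expect_cong simp: of_bool_def ctl_run_le)
  have Y_zero: "Y s k = 0" if "nxt s k \<noteq> k'" for s k
  proof -
    have "(H ts \<and> ctl (run ts) = k \<and> matches k' y v (core (Some s) (pop (run ts)))) \<longleftrightarrow> False" for ts
      using that by (auto simp: matches_def ctl_core pop_def simp del: core.simps)
    then show ?thesis
      unfolding Y_def by (simp only:) simp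
  qed
  have Y_same: "Y s k \<le> X k y v" if "k > M \<or> k = 0 \<and> \<not> s" for s k
    unfolding Y_def X_def
    by (rule expect_mono) (use that M in \<open>auto simp: matches_def pop_def split: if_splits\<close>)
  have Y_coin: "Y s k \<le> (if y = [] then X k [] v else if hd y = s then X k (tl y) v else 0)"
    if "0 < k" "k \<le> M" for s k
  proof -
    have "Y s k \<le> expect n P' (\<lambda>ts. of_bool (y = [] \<or> hd y = s) * of_bool (H ts \<and> matches k (tl y) v (pop (run ts))))"
      unfolding Y_def
      by (rule expect_mono) (use that in \<open>cases y; auto simp: matches_def pop_def split: if_splits\<close>)
    then show ?thesis
      unfolding expect_cmult by (auto simp: X_def split: if_splits)
  qed
  have Y_station: "Y True 0 \<le> c 0 * pr q y * pr \<alpha> v"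
  \<comment> \<open>A failed read leaves two empty stacks, which match only
    \<open>y = v = []\<close>; there the mass of the counter at 0 suffices. Otherwise the read
    succeeded and one can sum over its leaf.\<close>
  proof (cases "y = [] \<and> v = []")
    case True
    have "Y True 0 \<le> X 0 [] []"
      unfolding Y_def X_def by (rule expect_mono) (auto simp: matches_def pop_def)
    then show ?thesis
      using X[of 0 "[]" "[]"] True by simp
  next
    case False
    \<comment> \<open>The first \<open>L\<close> bits of \<open>v\<close> must come from the leaf
      and the others from the old output stack; \<open>take\<close> and \<open>drop\<close> also
      cover a \<open>v\<close> shorter than \<open>L\<close>.\<close>
    have "Y True 0 \<le> expect n P' (\<lambda>ts. \<Sum>l\<in>leaves. of_bool (prefix (take L v) (dec l)) *
        of_bool (H ts \<and> matches 0 (l @ y) (drop L v) (pop (run ts))))"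
      unfolding Y_def
    proof (rule expect_mono)
      fix ts
      let ?f = "\<lambda>l. of_bool (prefix (take L v) (dec l)) *
        of_bool (H ts \<and> matches 0 (l @ y) (drop L v) (pop (run ts))) :: real"
      have nn: "0 \<le> sum ?f leaves"
        by (rule sum_nonneg) auto
      show "of_bool (H ts \<and> ctl (run ts) = 0 \<and> matches k' y v (core (Some True) (pop (run ts)))) \<le> sum ?f leaves"
      proof (cases "H ts \<and> ctl (run ts) = 0 \<and> matches k' y v (core (Some True) (pop (run ts)))")
        case A: True
        obtain U B where run: "run ts = (0, U, B)"
          using A by (metis prod.collapse)
        from A run have y: "prefix y (fst (decode U (tl B)))" "prefix v (snd (decode U (tl B)))"
          by (auto simp: matches_def pop_def)
        then obtain l U' where l: "read_leaf U [] = Some (l, U')"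
          using False by (auto simp: decode_def split: option.splits)
        with read_leaf_SomeD[OF l] y have *: "l \<in> leaves" "U = l @ U'" "prefix y U'" "prefix v (dec l @ tl B)"
          by (auto simp: decode_def)
        obtain z where z: "dec l @ tl B = v @ z"
          using *(4) by (auto simp: prefix_def)
        have "dec l = take L v @ take (L - length v) z" "tl B = drop L v @ drop (L - length v) z"
          using arg_cong[OF z, of "take L"] arg_cong[OF z, of "drop L"] length_dec[OF *(1)] by simp_all
        then have "prefix (take L v) (dec l)" "prefix (drop L v) (tl B)"
          by (metis prefixI)+
        then have "?f l = 1"
          using A * run by (auto simp: matches_def pop_def)
        moreover have "?f l \<le> sum ?f leaves"
          by (rule member_le_sum) (use * finite_leaves in auto)
        ultimately have "1 \<le> sum ?f leaves"
          by simp
        then show ?thesis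
          by (rule order_trans[rotated]) simp
      next
        case False
        then have zero: "of_bool (H ts \<and> ctl (run ts) = 0 \<and> matches k' y v (core (Some True) (pop (run ts)))) = (0 :: real)"
          by simp
        show ?thesis
          using nn unfolding zero .
      qed
    qed
    also have "\<dots> = (\<Sum>l\<in>leaves. of_bool (prefix (take L v) (dec l)) * X 0 (l @ y) (drop L v))"
      unfolding expect_sum[OF finite_leaves] expect_cmult X_def by (rule refl)
    also have "\<dots> \<le> (\<Sum>l\<in>leaves. of_bool (prefix (take L v) (dec l)) * (c 0 * pr q (l @ y) * pr \<alpha> (drop L v)))"
      by (intro sum_mono mult_left_mono X) auto
    also have "\<dots> = (\<Sum>l | l \<in> leaves \<and> prefix (take L v) (dec l). pr q l) * (c 0 * pr q y * pr \<alpha> (drop L v))"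
      unfolding sum_distrib_right sum.inter_filter[OF finite_leaves] by (intro sum.cong refl) simp
    also have "\<dots> \<le> pr \<alpha> (take L v) * (c 0 * pr q y * pr \<alpha> (drop L v))"
      by (intro mult_right_mono dec_law_prefix mult_nonneg_nonneg c pr_nonneg) (use q \<alpha> in auto)
    also have "\<dots> = c 0 * pr q y * (pr \<alpha> (take L v) * pr \<alpha> (drop L v))"
      by (simp only: ac_simps)
    also have "pr \<alpha> (take L v) * pr \<alpha> (drop L v) = pr \<alpha> v"
      by (metis append_take_drop_id pr_append)
    finally show ?thesis .
  qed
  let ?w = "\<lambda>k. q * of_bool (nxt True k = k') + (1 - q) * of_bool (nxt False k = k')"
  have claim: "q * Y True k + (1 - q) * Y False k \<le> c k * ?w k * pr q y * pr \<alpha> v" for k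
  proof (cases "0 < k \<and> k \<le> M")
    case True
    then have nx: "nxt s k = k - 1" for s
      by (auto simp: nxt_def)
    show ?thesis
    proof (cases "k' = k - 1")
      case False
      then show ?thesis
        using Y_zero[of _ k] nx by simp
    next
      case k': True
      have "q * Y True k + (1 - q) * Y False k \<le>
        q * (if y = [] then X k [] v else if hd y = True then X k (tl y) v else 0) +
        (1 - q) * (if y = [] then X k [] v else if hd y = False then X k (tl y) v else 0)"
        using q True by (intro add_mono mult_left_mono Y_coin) auto
      also have "\<dots> = (if y = [] then 1 else if hd y then q else 1 - q) * X k (tl y) v"
        by (auto simp: algebra_simps)
      also have "\<dots> \<le> (if y = [] then 1 else if hd y then q else 1 - q) * (c k * pr q (tl y) * pr \<alpha> v)"
        using q by (intro mult_left_mono X) auto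
      also have "\<dots> = c k * pr q y * pr \<alpha> v"
        by (cases y) auto
      finally show ?thesis
        using k' nx by simp
    qed
  next
    case False
    have "Y s k \<le> of_bool (nxt s k = k') * (c k * pr q y * pr \<alpha> v)" for s
    proof (cases "nxt s k = k'")
      case True
      show ?thesis
      proof (cases "k = 0 \<and> s")
        case True
        with Y_station \<open>nxt s k = k'\<close> show ?thesis by simp
      next
        case B: False
        have "Y s k \<le> X k y v"
          by (rule Y_same) (use False B in auto)
        with X[of k y v] True show ?thesis by simp
      qed
    qed (simp add: Y_zero)
    then have "q * Y True k + (1 - q) * Y False k \<le>
      q * (of_bool (nxt True k = k') * (c k * pr q y * pr \<alpha> v)) +
      (1 - q) * (of_bool (nxt False k = k') * (c k * pr q y * pr \<alpha> v))"
      using q by (intro add_mono mult_left_mono) auto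
    then show ?thesis
      by (simp add: algebra_simps)
  qed
  have "expect (Suc n) P (\<lambda>ts. of_bool (H (tl ts) \<and> matches k' y v (run ts))) =
    (1 - e) * X k' y v + e * (q * (\<Sum>k\<le>2 * M. Y True k) + (1 - q) * (\<Sum>k\<le>2 * M. Y False k))"
    by (subst expect_Suc_coin[where P = P, OF coin e_def]) (simp add: X_def P'_def[symmetric] Y_sum[symmetric])
  also have "\<dots> = (1 - e) * X k' y v + e * (\<Sum>k\<le>2 * M. q * Y True k + (1 - q) * Y False k)"
    by (simp add: sum.distrib sum_distrib_left)
  also have "\<dots> \<le> (1 - e) * (c k' * pr q y * pr \<alpha> v) + e * (\<Sum>k\<le>2 * M. c k * ?w k * pr q y * pr \<alpha> v)"
    using e by (intro add_mono mult_left_mono X sum_mono claim) auto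
  also have "\<dots> = advance e c k' * pr q y * pr \<alpha> v"
    by (simp add: advance_def algebra_simps sum_distrib_left sum_distrib_right)
  finally show "expect (Suc n) P (\<lambda>ts. of_bool (H (tl ts) \<and> matches k' y v (run ts)))
      \<le> advance (1 - pmf (P 0) None) c k' * pr q y * pr \<alpha> v"
    by (simp add: e_def)
qed

text \<open>A nonempty \<open>v\<close> forces the popped bit to have been present, and its two
  values have total weight 1. For \<open>v = []\<close> the pop changes nothing that is
  observed.\<close>

lemma dominated_pop:
  assumes dom: "dominated run n P H c"
  shows "dominated (\<lambda>ts. pop (run ts)) n P H c"
  unfolding dominated_def
proof (intro allI)
  fix k y v
  show "expect n P (\<lambda>ts. of_bool (H ts \<and> matches k y v (pop (run ts)))) \<le> c k * pr q y * pr \<alpha> v"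
  proof (cases "v = []")
    case True
    then show ?thesis
      using dominatedD[OF dom, of k y "[]"] by (simp add: matches_def pop_def)
  next
    case False
    have "expect n P (\<lambda>ts. of_bool (H ts \<and> matches k y v (pop (run ts)))) \<le>
      expect n P (\<lambda>ts. of_bool (H ts \<and> matches k y (True # v) (run ts)) + of_bool (H ts \<and> matches k y (False # v) (run ts)))"
    proof (rule expect_mono)
      fix ts
      obtain k1 U B where "run ts = (k1, U, B)" by (metis prod.collapse)
      then show "of_bool (H ts \<and> matches k y v (pop (run ts))) \<le> (of_bool (H ts \<and> matches k y (True # v) (run ts))
        + of_bool (H ts \<and> matches k y (False # v) (run ts)) :: real)"
        using False by (cases B) (auto simp: matches_def pop_def)
    qed
    also have "\<dots> \<le> c k * pr q y * pr \<alpha> (True # v) + c k * pr q y * pr \<alpha> (False # v)"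
      unfolding expect_add by (intro add_mono dominatedD[OF dom])
    finally show ?thesis
      by (simp add: algebra_simps)
  qed
qed

text \<open>Recording the top bit moves its factor from the stack bound into \<open>c\<close>, and
  the rest of the stack is dominated given the enlarged history: this is the independence of the
  outputs.\<close>

lemma dominated_output:
  assumes dom: "dominated run n P H c"
  shows "dominated (\<lambda>ts. pop (run ts)) n P (\<lambda>ts. H ts \<and> outs (run ts) \<noteq> [] \<and> hd (outs (run ts)) = b)
    (\<lambda>k. (if b then \<alpha> else 1 - \<alpha>) * c k)"
  unfolding dominated_def
proof (intro allI)
  fix k y v
  have *: "(H ts \<and> outs (run ts) \<noteq> [] \<and> hd (outs (run ts)) = b) \<and> matches k y v (pop (run ts)) \<longleftrightarrow>
    H ts \<and> matches k y (b # v) (run ts)" for ts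
    by (cases "outs (run ts)") (auto simp: matches_def pop_def)
  show "expect n P (\<lambda>ts. of_bool ((H ts \<and> outs (run ts) \<noteq> [] \<and> hd (outs (run ts)) = b) \<and> matches k y v (pop (run ts))))
    \<le> (if b then \<alpha> else 1 - \<alpha>) * c k * pr q y * pr \<alpha> v"
    unfolding * using dominatedD[OF dom, of k y "b # v"] by (simp add: ac_simps split: if_splits)
qed

text \<open>The head of \<open>bs\<close> is the output at the left end of the window; later entries
  belong to shorter windows with the same right end.\<close>

primrec emits :: "bool list \<Rightarrow> bool option list \<Rightarrow> bool" where
  "emits [] ts \<longleftrightarrow> True"
| "emits (b # bs) ts \<longleftrightarrow> emits bs (tl ts) \<and> outs (run ts) \<noteq> [] \<and> hd (outs (run ts)) = b"

lemma dominated_True: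
  assumes "\<And>i. coin_law (P i)"
  shows "\<exists>c. (\<forall>k. 0 \<le> c k) \<and> (\<Sum>k\<le>2 * M. c k) = 1 \<and> dominated run n P (\<lambda>_. True) c"
  using assms
proof (induction n arbitrary: P)
  case 0
  have "dominated run 0 P (\<lambda>_. True) (\<lambda>k. of_bool (k = 2 * M))"
    unfolding dominated_def
    by (auto simp: matches_def intro!: mult_nonneg_nonneg pr_nonneg) (use q \<alpha> in auto)
  then show ?case
    by (intro exI[of _ "\<lambda>k. of_bool (k = 2 * M)"]) (simp add: of_bool_def)
next
  case (Suc n)
  from Suc.IH[of "\<lambda>i. P (Suc i)"] Suc.prems obtain c where c: "\<And>k. 0 \<le> c k" "(\<Sum>k\<le>2 * M. c k) = 1"
    "dominated run n (\<lambda>i. P (Suc i)) (\<lambda>_. True) c"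
    by blast
  have "dominated run (Suc n) P (\<lambda>_. True) (advance (1 - pmf (P 0) None) c)"
    by (rule dominated_core[OF Suc.prems c(1) dominated_pop[OF c(3)]])
  then show ?case
    using c by (intro exI[of _ "advance (1 - pmf (P 0) None) c"]) (auto simp: sum_advance pmf_le_1 intro!: advance_nonneg)
qed

text \<open>The letters right of the first \<open>length bs\<close> ones are covered by
  \<open>dominated_True\<close>. Then each letter is a machine step, which keeps the mass by
  \<open>sum_advance\<close>, followed by recording a bit, which multiplies it by the probability of
  that bit.\<close>

lemma dominated_emits:
  assumes "length bs \<le> n" "\<And>i. coin_law (P i)"
  shows "\<exists>c. (\<forall>k. 0 \<le> c k) \<and> (\<Sum>k\<le>2 * M. c k) = pr \<alpha> bs \<and> dominated (\<lambda>ts. pop (run ts)) n P (emits bs) c"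
  using assms
proof (induction bs arbitrary: n P)
  case Nil
  show ?case
    using dominated_True[of P n, OF Nil(2)] dominated_pop[of n P "\<lambda>_. True"] by auto
next
  case (Cons b bs)
  then obtain m where [simp]: "n = Suc m"
    by (cases n) auto
  from Cons.IH[of m "\<lambda>i. P (Suc i)"] Cons.prems obtain c where c: "\<And>k. 0 \<le> c k" "(\<Sum>k\<le>2 * M. c k) = pr \<alpha> bs"
    "dominated (\<lambda>ts. pop (run ts)) m (\<lambda>i. P (Suc i)) (emits bs) c"
    by auto
  note dominated_output[OF dominated_core[OF Cons.prems(2) c(1,3)], of b]
  then show ?case
    using c \<alpha>
    by (intro exI[of _ "\<lambda>k. (if b then \<alpha> else 1 - \<alpha>) * advance (1 - pmf (P 0) None) c k"])
      (auto simp: sum_advance pmf_le_1 simp flip: sum_distrib_left intro!: advance_nonneg mult_nonneg_nonneg)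
qed

lemma expect_emits_le:
  assumes "length bs \<le> n" "\<And>i. coin_law (P i)"
  shows "expect n P (\<lambda>ts. of_bool (emits bs ts)) \<le> pr \<alpha> bs"
proof -
  obtain c where c: "\<And>k. 0 \<le> c k" "(\<Sum>k\<le>2 * M. c k) = pr \<alpha> bs"
    "dominated (\<lambda>ts. pop (run ts)) n P (emits bs) c"
    using dominated_emits[of bs n P] assms by blast
  have "expect n P (\<lambda>ts. of_bool (emits bs ts)) =
    (\<Sum>k\<le>2 * M. expect n P (\<lambda>ts. of_bool (emits bs ts \<and> matches k [] [] (pop (run ts)))))"
    by (subst expect_sum[symmetric]) (auto intro!: expect_cong simp: of_bool_def matches_def pop_def ctl_run_le)
  also have "\<dots> \<le> (\<Sum>k\<le>2 * M. c k)"
    using dominatedD[OF c(3), of _ "[]" "[]"] by (intro sum_mono) simp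
  finally show ?thesis
    using c by simp
qed

section \<open>Exponentially fast synchronisation of the counter\<close>

lemma expect_Suc_le:
  assumes "coin_law (P 0)" and e: "e = 1 - pmf (P 0) None"
    and "\<And>ts. (1 - e) * F (None # ts) + e * (q * F (Some True # ts) + (1 - q) * F (Some False # ts)) \<le> G ts"
  shows "expect (Suc n) P F \<le> expect n (\<lambda>i. P (Suc i)) G"
  unfolding expect_Suc_coin[where P = P and F = F, OF assms(1,2)] expect_cmult[symmetric] expect_add[symmetric]
  by (rule expect_mono) (rule assms(3))

definition good_law :: "real \<Rightarrow> (nat \<Rightarrow> bool option pmf) \<Rightarrow> bool" where
  "good_law \<delta> P \<longleftrightarrow> (\<forall>i. coin_law (P i) \<and> \<delta> \<le> 1 - pmf (P i) None)"

lemma good_law_Suc: "good_law \<delta> P \<Longrightarrow> good_law \<delta> (\<lambda>i. P (Suc i))"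
  by (simp add: good_law_def)

lemma ctl_run_Some: "ctl (run (Some s # ts)) = nxt s (ctl (run ts))"
  by (simp add: ctl_core pop_def del: core.simps)

text \<open>A Lyapunov argument: \<open>G\<close> grows with the number of tails still missing and
  contracts in mean by a fixed factor per letter.\<close>

lemma expect_unsync:
  assumes \<delta>: "0 < \<delta>" "\<delta> \<le> 1" and "good_law \<delta> P"
  shows "expect n P (\<lambda>ts. of_bool (M < ctl (run ts))) \<le> 2 * (1 - \<delta> * ((1 - q) / 2) ^ M) ^ n"
proof -
  \<comment> \<open>A tail turns \<open>x = t ^ (k - M)\<close> into \<open>x / t\<close>, and
    \<open>(1 - q) * (x / t) = 2 * x\<close>. So even if a head is charged the maximal value 1, a
    coin lowers the mean of \<open>G\<close> from \<open>1 - x\<close> to at most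
    \<open>1 - 2 * x\<close>.\<close>
  define t where "t = (1 - q) / 2"
  have t: "0 < t" "t < 1 / 2"
    using q by (auto simp: t_def)
  define \<xi> where "\<xi> = t ^ M"
  have \<xi>: "0 < \<xi>" "\<xi> \<le> 1"
    using t by (auto simp: \<xi>_def power_le_one)
  have \<delta>\<xi>: "\<delta> * \<xi> \<le> 1"
    using \<delta> \<xi> by (simp add: mult_le_one)
  define G where "G k = (if M < k then 1 - t ^ (k - M) else 0)" for k
  have G_step: "(1 - e) * G k + e * (q * G (nxt True k) + (1 - q) * G (nxt False k)) \<le> (1 - \<delta> * \<xi>) * G k"
    if "\<delta> \<le> e" "e \<le> 1" "k \<le> 2 * M" for e k
  proof (cases "M < k")
    case True
    define x where "x = t ^ (k - M)"
    have x: "0 < x" "\<xi> \<le> x" "x \<le> 1"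
      using t that by (auto simp: x_def \<xi>_def power_le_one intro!: power_decreasing)
    have "q * G (nxt True k) \<le> q * 1"
      using q t by (intro mult_left_mono) (auto simp: G_def)
    moreover have "(1 - q) * G (nxt False k) = (1 - q) - 2 * x"
    proof (cases "k = Suc M")
      case True
      then show ?thesis by (simp add: G_def nxt_def x_def t_def)
    next
      case False
      have "k - M = Suc (k - 1 - M)"
        using True by simp
      then have "x = t * t ^ (k - 1 - M)"
        unfolding x_def by simp
      then show ?thesis
        using True False by (simp add: G_def nxt_def t_def algebra_simps)
    qed
    ultimately have "q * G (nxt True k) + (1 - q) * G (nxt False k) \<le> 1 - 2 * x"
      by simp
    then have "e * (q * G (nxt True k) + (1 - q) * G (nxt False k)) \<le> e * (1 - 2 * x)"
      using that \<delta> by (intro mult_left_mono) auto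
    moreover have "(1 - x) * (\<delta> * \<xi>) \<le> 1 * (e * x)"
      using x \<xi> \<delta> that by (intro mult_mono) auto
    moreover have "G k = 1 - x"
      using True by (simp add: G_def x_def)
    moreover have "(1 - e) * (1 - x) + e * (1 - 2 * x) = (1 - x) - e * x"
      "(1 - \<delta> * \<xi>) * (1 - x) = (1 - x) - (1 - x) * (\<delta> * \<xi>)"
      by (simp_all add: algebra_simps)
    ultimately show ?thesis
      by simp
  qed (use M in \<open>auto simp: G_def nxt_def\<close>)
  have EG: "expect n P (\<lambda>ts. G (ctl (run ts))) \<le> (1 - \<delta> * \<xi>) ^ n"
    using assms(3)
  proof (induction n arbitrary: P)
    case 0
    then show ?case using t by (simp add: G_def)
  next
    case (Suc n)
    let ?e = "1 - pmf (P 0) None"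
    have "expect (Suc n) P (\<lambda>ts. G (ctl (run ts))) \<le> expect n (\<lambda>i. P (Suc i)) (\<lambda>ts. (1 - \<delta> * \<xi>) * G (ctl (run ts)))"
    proof (rule expect_Suc_le[OF _ refl])
      show "coin_law (P 0)"
        using Suc.prems by (simp add: good_law_def)
      fix ts
      have "ctl (run (None # ts)) = ctl (run ts)"
        by (simp add: pop_def)
      then show "(1 - ?e) * G (ctl (run (None # ts))) + ?e * (q * G (ctl (run (Some True # ts))) +
          (1 - q) * G (ctl (run (Some False # ts)))) \<le> (1 - \<delta> * \<xi>) * G (ctl (run ts))"
        unfolding ctl_run_Some using G_step[of ?e "ctl (run ts)"] Suc.prems ctl_run_le[of ts]
        by (simp add: good_law_def)
    qed
    also have "\<dots> \<le> (1 - \<delta> * \<xi>) * (1 - \<delta> * \<xi>) ^ n"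
      unfolding expect_cmult using \<delta>\<xi> Suc.IH[OF good_law_Suc[OF Suc.prems]] by (intro mult_left_mono) auto
    finally show ?case by simp
  qed
  \<comment> \<open>Unsynchronised states have \<open>k - M \<ge> 1\<close>, hence
    \<open>G \<ge> 1 - t \<ge> 1 / 2\<close>; this is the factor 2.\<close>
  have "expect n P (\<lambda>ts. of_bool (M < ctl (run ts))) \<le> expect n P (\<lambda>ts. 2 * G (ctl (run ts)))"
  proof (rule expect_mono)
    fix ts
    show "of_bool (M < ctl (run ts)) \<le> 2 * G (ctl (run ts))"
    proof (cases "M < ctl (run ts)")
      case True
      then have "t ^ (ctl (run ts) - M) \<le> t ^ 1"
        using t by (intro power_decreasing) auto
      with True t show ?thesis by (simp add: G_def)
    qed (simp add: G_def)
  qed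
  then show ?thesis
    unfolding expect_cmult using EG by (simp add: \<xi>_def t_def)
qed

section \<open>Exponential moments of the coin stack\<close>

text \<open>
  The number of coins read depends on the coins themselves. Hence the exponential moment of the
  stack height has to be controlled jointly with the law of the top of the stack.
\<close>

definition coin_weight :: "real \<Rightarrow> nat \<Rightarrow> bool list \<Rightarrow> bool option list \<Rightarrow> real" where
  "coin_weight z k y ts = of_bool (ctl (run ts) = k \<and> prefix y (coins (run ts))) * z ^ length (coins (run ts))"

lemma coin_weight_nonneg: "0 \<le> z \<Longrightarrow> 0 \<le> coin_weight z k y ts"
  by (simp add: coin_weight_def)

lemma power_length_diff:
  fixes z :: real
  assumes "0 < z" "z \<le> 1" "m \<le> n" "n - m \<le> d"
  shows "z ^ m \<le> (1 / z) ^ d * z ^ n"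
proof -
  have "z ^ m = (1 / z) ^ (n - m) * z ^ n"
    using assms by (simp add: power_diff power_divide field_simps)
  also have "\<dots> \<le> (1 / z) ^ d * z ^ n"
    using assms by (intro mult_right_mono power_increasing) auto
  finally show ?thesis .
qed

lemma read_leaf_None_short:
  assumes "read_leaf U [] = None"
  shows "length U \<le> T" "\<not> prefix (replicate r True) U \<Longrightarrow> length U \<le> r"
  using read_leaf_NoneD[OF assms] leaf_long[of U] leaf_short[of U]
  by (metis append_Nil nat_le_linear)+

text \<open>A failed read empties the stack, but it only fails on a stack no longer than what a read
  may consume. So in all cases at most \<open>r\<close> coins are lost, or \<open>T\<close> if the
  stack starts with \<open>r\<close> heads.\<close>

lemma decode_coins_Nil:
  fixes z :: real
  assumes z: "0 < z" "z \<le> 1"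
  shows "z ^ length (fst (decode U B)) \<le>
    (1 / z) ^ r * z ^ length U + (1 / z) ^ T * (of_bool (prefix (replicate r True) U) * z ^ length U)"
proof -
  let ?U' = "fst (decode U B)"
  define d where "d = (if prefix (replicate r True) U then T else r)"
  have d: "length ?U' \<le> length U \<and> length U - length ?U' \<le> d"
  proof (cases "read_leaf U []")
    case None
    then show ?thesis
      using read_leaf_None_short[OF None] by (auto simp: decode_def d_def)
  next
    case (Some a)
    then obtain l U' where l: "read_leaf U [] = Some (l, U')"
      by (cases a) auto
    with read_leaf_SomeD[OF l] leaf_cases[of l] r_le_T show ?thesis
      by (auto simp: decode_def d_def)
  qed
  then have "z ^ length ?U' \<le> (1 / z) ^ d * z ^ length U"
    using z by (intro power_length_diff conjunct1[OF d] conjunct2[OF d]) auto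
  then show ?thesis
    using z by (auto simp: d_def split: if_splits intro: order_trans)
qed

text \<open>A nonempty \<open>y\<close> left on top certifies a successful read. Demanding
  \<open>l @ y\<close> before the read keeps the law of the consumed coins available.\<close>

lemma decode_coins_Cons:
  fixes z :: real
  assumes z: "0 < z" "z \<le> 1" and y: "y \<noteq> []"
  shows "of_bool (prefix y (fst (decode U B))) * z ^ length (fst (decode U B)) \<le>
    (\<Sum>l\<in>leaves. (1 / z) ^ length l * (of_bool (prefix (l @ y) U) * z ^ length U))" (is "?lhs \<le> sum ?f _")
proof (cases "prefix y (fst (decode U B))")
  case True
  then obtain l U' where l: "read_leaf U [] = Some (l, U')"
    using y by (auto simp: decode_def split: option.splits)
  with read_leaf_SomeD[OF l] have *: "l \<in> leaves" "U = l @ U'" "fst (decode U B) = U'"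
    by (auto simp: decode_def)
  have "?lhs = z ^ length U'"
    using True * by simp
  also have "\<dots> = ?f l"
    using True * z by (simp add: power_add power_divide)
  also have "?f l \<le> sum ?f leaves"
    by (rule member_le_sum) (use * finite_leaves z in auto)
  finally show ?thesis .
qed (use z in \<open>auto intro!: sum_nonneg\<close>)

lemma sum_leaves_le_1: "(\<Sum>l\<in>leaves. pr q l) \<le> 1"
  using dec_law_prefix[of "[]"] by simp

text \<open>Exponential moment of the reading cost: ordinary leaves have length at most
  \<open>r\<close>, and those of length \<open>T\<close> have total mass at most
  \<open>q ^ r\<close>.\<close>

lemma sum_leaves_weight:
  assumes z: "0 < z" "z \<le> 1"
  shows "(\<Sum>l\<in>leaves. (1 / z) ^ length l * pr q l) \<le> (1 / z) ^ r + q ^ r * (1 / z) ^ T"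
proof -
  have nn: "0 \<le> pr q l" for l
    using q by (intro pr_nonneg) auto
  have "(1 / z) ^ length l * pr q l \<le> (1 / z) ^ r * pr q l + (1 / z) ^ T * (of_bool (r < length l) * pr q l)"
    if "l \<in> leaves" for l
  proof (cases "r < length l")
    case True
    with leaf_cases[OF that] z nn[of l] show ?thesis by simp
  next
    case False
    then have "(1 / z) ^ length l \<le> (1 / z) ^ r"
      using z by (intro power_increasing) auto
    then show ?thesis
      using False nn by (simp add: mult_right_mono)
  qed
  then have "(\<Sum>l\<in>leaves. (1 / z) ^ length l * pr q l) \<le>
      (\<Sum>l\<in>leaves. (1 / z) ^ r * pr q l + (1 / z) ^ T * (of_bool (r < length l) * pr q l))"
    by (rule sum_mono)
  also have "\<dots> = (1 / z) ^ r * (\<Sum>l\<in>leaves. pr q l) + (1 / z) ^ T * (\<Sum>l | l \<in> leaves \<and> r < length l. pr q l)"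
    unfolding sum_distrib_left sum.inter_filter[OF finite_leaves] sum.distrib[symmetric]
    by (intro sum.cong refl) simp
  also have "\<dots> \<le> (1 / z) ^ r * 1 + (1 / z) ^ T * q ^ r"
    using z by (intro add_mono mult_left_mono sum_leaves_le_1 long_leaves) auto
  finally show ?thesis by (simp add: mult.commute)
qed

lemma nxt_eqD:
  "nxt s j = k \<Longrightarrow> 0 < k \<Longrightarrow> k < M \<Longrightarrow> j = Suc k"
  "nxt True j = 0 \<Longrightarrow> j = Suc 0"
  "nxt False j = 0 \<Longrightarrow> j = Suc 0 \<or> j = 0 \<or> j = Suc M"
  using M by (auto simp: nxt_def split: if_splits)

text \<open>Supersolution step. Weighting counter \<open>k\<close> by \<open>g k\<close>, the
  moments contract by \<open>\<kappa>\<close> per coin: \<open>g_M\<close> treats a read,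
  \<open>g_mid\<close> storing, \<open>g_0\<close> the idle state. A letter is a coin with
  probability at least \<open>\<delta>\<close>, whence the factor
  \<open>1 - \<delta> * (1 - \<kappa>)\<close>; \<open>D\<close> pays for mass newly
  synchronised.\<close>

lemma expect_coins_step:
  fixes z :: real
  assumes z: "0 < z" "z \<le> 1" and coin: "coin_law (P 0)" and e: "\<delta> \<le> 1 - pmf (P 0) None" and \<delta>: "0 < \<delta>"
    and g: "\<And>k. 0 \<le> g k" "g 0 = 1" and K: "0 \<le> K" and D: "0 \<le> D" and lam: "\<kappa> \<le> 1"
    and g_M: "q * ((1 / z) ^ r + q ^ r * (1 / z) ^ T) \<le> \<kappa> * g M"
    and g_mid: "\<And>k. 0 < k \<Longrightarrow> k < M \<Longrightarrow> z * g (Suc k) \<le> \<kappa> * g k"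
    and g_0: "(1 - q) + z * g 1 \<le> \<kappa>"
    and IH: "\<And>k y. k \<le> M \<Longrightarrow> expect n (\<lambda>i. P (Suc i)) (coin_weight z k y) \<le> K * g k * pr q y"
    and unsync: "expect n (\<lambda>i. P (Suc i)) (\<lambda>ts. of_bool (M < ctl (run ts))) \<le> D"
    and k: "k \<le> M"
  shows "expect (Suc n) P (coin_weight z k y) \<le> ((1 - \<delta> * (1 - \<kappa>)) * K + D) * g k * pr q y"
proof -
  define P' where "P' = (\<lambda>i. P (Suc i))"
  define e where "e = 1 - pmf (P 0) None"
  have e01: "\<delta> \<le> e" "0 \<le> e" "e \<le> 1"
    using e \<delta> by (auto simp: e_def pmf_le_1)
  define X where "X k y = expect n P' (coin_weight z k y)" for k y
  have X: "X k y \<le> K * g k * pr q y" if "k \<le> M" for k y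
    using IH[OF that] by (simp add: X_def P'_def)
  have prn: "0 \<le> pr q y" for y
    using q by (intro pr_nonneg) auto
  define \<zeta> where "\<zeta> = (1 / z) ^ r + q ^ r * (1 / z) ^ T"
  define N where "N = expect n P' (\<lambda>ts. of_bool (M < ctl (run ts)))"
  define Y where "Y s = expect n P' (\<lambda>ts. coin_weight z k y (Some s # ts))" for s
  have N: "0 \<le> N" "N \<le> D"
    using unsync by (auto simp: N_def P'_def intro!: expect_nonneg)
  have Y_coin: "q * expect n P' (\<lambda>ts. of_bool (ctl (run ts) = Suc j) * coin_weight z k y (Some True # ts)) +
      (1 - q) * expect n P' (\<lambda>ts. of_bool (ctl (run ts) = Suc j) * coin_weight z k y (Some False # ts))
      \<le> K * (z * g (Suc j)) * pr q y" if "Suc j \<le> M" for j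
  proof -
    have Ys: "expect n P' (\<lambda>ts. of_bool (ctl (run ts) = Suc j) * coin_weight z k y (Some s # ts)) \<le>
      (if y = [] \<or> hd y = s then z * X (Suc j) (tl y) else 0)" for s
    proof -
      have "expect n P' (\<lambda>ts. of_bool (ctl (run ts) = Suc j) * coin_weight z k y (Some s # ts)) \<le>
        expect n P' (\<lambda>ts. (if y = [] \<or> hd y = s then z else 0) * coin_weight z (Suc j) (tl y) ts)"
        by (rule expect_mono) (use that z in \<open>cases y; auto simp: coin_weight_def pop_def split: if_splits\<close>)
      then show ?thesis
        unfolding expect_cmult X_def by (auto split: if_splits)
    qed
    have "q * expect n P' (\<lambda>ts. of_bool (ctl (run ts) = Suc j) * coin_weight z k y (Some True # ts)) +
      (1 - q) * expect n P' (\<lambda>ts. of_bool (ctl (run ts) = Suc j) * coin_weight z k y (Some False # ts)) \<le>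
      q * (if y = [] \<or> hd y = True then z * X (Suc j) (tl y) else 0) + (1 - q) * (if y = [] \<or> hd y = False then z * X (Suc j) (tl y) else 0)"
      using q by (intro add_mono mult_left_mono Ys) auto
    also have "\<dots> = (if y = [] then 1 else if hd y then q else 1 - q) * z * X (Suc j) (tl y)"
      by (auto simp: algebra_simps)
    also have "\<dots> \<le> (if y = [] then 1 else if hd y then q else 1 - q) * z * (K * g (Suc j) * pr q (tl y))"
      using q z that by (intro mult_left_mono X) auto
    also have "\<dots> = K * (z * g (Suc j)) * pr q y"
      by (cases y) auto
    finally show ?thesis .
  qed
  have split: "coin_weight z k y (Some s # ts) = 0"
    if "nxt s (ctl (run ts)) \<noteq> k" for s ts
    unfolding coin_weight_def ctl_run_Some using that by simp
  have main: "q * Y True + (1 - q) * Y False \<le> \<kappa> * (K * g k * pr q y) + D * g k * pr q y"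
  proof -
    have DD: "0 \<le> D * g k * pr q y"
      using D g prn by simp
    \<comment> \<open>Counter \<open>M\<close> is reached only by a read, a value strictly between
      only by storing; 0 is reached by storing the last coin, by an idle tail or by synchronisation
      from \<open>Suc M\<close>.\<close>
    consider "k = M" | "0 < k" "k < M" | "k = 0"
      using k by force
    then show ?thesis
    proof cases
      case 1
      have "Y False = 0"
      proof -
        have "coin_weight z k y (Some False # ts) = 0" for ts
          using M 1 by (intro split) (auto simp: nxt_def)
        then show ?thesis by (simp add: Y_def)
      qed
      moreover have "Y True \<le> \<zeta> * K * pr q y"
      \<comment> \<open>For empty \<open>y\<close> failed reads count too, and
        \<open>decode_coins_Nil\<close> covers them; for nonempty \<open>y\<close> the read
        succeeded.\<close>
      proof (cases "y = []")
        case True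
        have "Y True \<le> expect n P' (\<lambda>ts. (1 / z) ^ r * coin_weight z 0 [] ts + (1 / z) ^ T * coin_weight z 0 (replicate r True) ts)"
          unfolding Y_def
        proof (rule expect_mono)
          fix ts
          show "coin_weight z k y (Some True # ts) \<le> (1 / z) ^ r * coin_weight z 0 [] ts + (1 / z) ^ T * coin_weight z 0 (replicate r True) ts"
          proof (cases "ctl (run ts) = 0")
            case True
            then show ?thesis
              using decode_coins_Nil[OF z, of "coins (run ts)" "tl (outs (run ts))"] 1 \<open>y = []\<close>
              by (simp add: coin_weight_def pop_def)
          next
            case False
            then have "coin_weight z k y (Some True # ts) = 0"
              using M 1 by (intro split) (auto simp: nxt_def)
            then show ?thesis
              using z by (auto intro!: add_nonneg_nonneg mult_nonneg_nonneg coin_weight_nonneg)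
          qed
        qed
        also have "\<dots> = (1 / z) ^ r * X 0 [] + (1 / z) ^ T * X 0 (replicate r True)"
          by (simp only: expect_add expect_cmult X_def)
        also have "\<dots> \<le> (1 / z) ^ r * (K * g 0 * pr q []) + (1 / z) ^ T * (K * g 0 * pr q (replicate r True))"
          using z by (intro add_mono mult_left_mono X) auto
        finally show ?thesis
          using True g by (simp add: \<zeta>_def algebra_simps)
      next
        case False
        have "Y True \<le> expect n P' (\<lambda>ts. \<Sum>l\<in>leaves. (1 / z) ^ length l * coin_weight z 0 (l @ y) ts)"
          unfolding Y_def
        proof (rule expect_mono)
          fix ts
          show "coin_weight z k y (Some True # ts) \<le> (\<Sum>l\<in>leaves. (1 / z) ^ length l * coin_weight z 0 (l @ y) ts)"
          proof (cases "ctl (run ts) = 0")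
            case True
            then show ?thesis
              using decode_coins_Cons[OF z False, of "coins (run ts)" "tl (outs (run ts))"] 1
              by (simp add: coin_weight_def pop_def)
          next
            case False
            then have "coin_weight z k y (Some True # ts) = 0"
              using M 1 by (intro split) (auto simp: nxt_def)
            then show ?thesis
              using z by (auto intro!: sum_nonneg mult_nonneg_nonneg coin_weight_nonneg)
          qed
        qed
        also have "\<dots> = (\<Sum>l\<in>leaves. (1 / z) ^ length l * X 0 (l @ y))"
          unfolding expect_sum[OF finite_leaves] expect_cmult X_def by (rule refl)
        also have "\<dots> \<le> (\<Sum>l\<in>leaves. (1 / z) ^ length l * (K * g 0 * pr q (l @ y)))"
          using z by (intro sum_mono mult_left_mono X) auto
        also have "\<dots> = (\<Sum>l\<in>leaves. (1 / z) ^ length l * pr q l) * (K * pr q y)"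
          using g unfolding sum_distrib_right by (intro sum.cong refl) simp
        also have "\<dots> \<le> \<zeta> * (K * pr q y)"
          unfolding \<zeta>_def using K prn z by (intro mult_right_mono sum_leaves_weight) auto
        finally show ?thesis by (simp add: mult.assoc)
      qed
      ultimately have "q * Y True + (1 - q) * Y False \<le> q * (\<zeta> * K * pr q y)"
        using q by simp
      also have "\<dots> = (q * \<zeta>) * (K * pr q y)"
        by simp
      also have "\<dots> \<le> (\<kappa> * g M) * (K * pr q y)"
        using g_M K prn unfolding \<zeta>_def by (intro mult_right_mono) auto
      also have "\<dots> = \<kappa> * (K * g k * pr q y)"
        using 1 by simp
      finally show ?thesis using DD by simp
    next
      case 2
      have "coin_weight z k y (Some s # ts) = of_bool (ctl (run ts) = Suc k) * coin_weight z k y (Some s # ts)" for s ts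
        using split[of s ts] 2 nxt_eqD(1)[of s "ctl (run ts)" k] by (cases "nxt s (ctl (run ts)) = k") auto
      then have "Y s = expect n P' (\<lambda>ts. of_bool (ctl (run ts) = Suc k) * coin_weight z k y (Some s # ts))" for s
        unfolding Y_def by (intro expect_cong)
      with Y_coin[of k] 2 have "q * Y True + (1 - q) * Y False \<le> K * (z * g (Suc k)) * pr q y"
        by simp
      also have "\<dots> \<le> K * (\<kappa> * g k) * pr q y"
        using g_mid 2 K prn by (intro mult_right_mono mult_left_mono) auto
      finally show ?thesis using DD by (simp add: algebra_simps)
    next
      case 3
      let ?C = "\<lambda>s. expect n P' (\<lambda>ts. of_bool (ctl (run ts) = Suc 0) * coin_weight z k y (Some s # ts))"
      have YT: "Y True \<le> ?C True"
        unfolding Y_def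
      proof (rule expect_mono)
        fix ts
        show "coin_weight z k y (Some True # ts) \<le> of_bool (ctl (run ts) = Suc 0) * coin_weight z k y (Some True # ts)"
          using split[of True ts] 3 nxt_eqD(2)[of "ctl (run ts)"] by (cases "nxt True (ctl (run ts)) = 0") auto
      qed
      have "Y False \<le> expect n P' (\<lambda>ts. of_bool (ctl (run ts) = Suc 0) * coin_weight z k y (Some False # ts) +
        (coin_weight z 0 y ts + of_bool (y = []) * of_bool (M < ctl (run ts))))"
        unfolding Y_def
      proof (rule expect_mono)
        fix ts
        consider "ctl (run ts) = Suc 0" | "ctl (run ts) = 0" | "ctl (run ts) = Suc M" | "nxt False (ctl (run ts)) \<noteq> 0"
          using nxt_eqD(3)[of "ctl (run ts)"] by (cases "nxt False (ctl (run ts)) = 0") auto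
        then show "coin_weight z k y (Some False # ts) \<le> of_bool (ctl (run ts) = Suc 0) * coin_weight z k y (Some False # ts) +
          (coin_weight z 0 y ts + of_bool (y = []) * of_bool (M < ctl (run ts)))"
        proof cases
          case 1
          then show ?thesis using z coin_weight_nonneg[of z 0 y ts] by (simp add: add_nonneg_nonneg)
        next
          case 2
          then show ?thesis using 3 by (simp add: coin_weight_def pop_def)
        next
          case 4: 3
          then have "coins (run ts) = []"
            using unsync_empty[of ts] by simp
          with 4 show ?thesis using 3 M by (auto simp: coin_weight_def pop_def)
        next
          case 4
          then have "coin_weight z k y (Some False # ts) = 0"
            using 3 by (intro split) simp
          then show ?thesis using z by (auto intro!: add_nonneg_nonneg mult_nonneg_nonneg coin_weight_nonneg)
        qed
      qed
      also have "\<dots> = ?C False + (X 0 y + of_bool (y = []) * N)"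
        by (simp only: expect_add expect_cmult X_def N_def)
      finally have YF: "Y False \<le> ?C False + (X 0 y + of_bool (y = []) * N)" .
      have "q * Y True + (1 - q) * Y False \<le> q * ?C True + (1 - q) * (?C False + (X 0 y + of_bool (y = []) * N))"
        using q YT YF by (intro add_mono mult_left_mono) auto
      also have "\<dots> = (q * ?C True + (1 - q) * ?C False) + (1 - q) * X 0 y + (1 - q) * (of_bool (y = []) * N)"
        by (simp add: algebra_simps)
      also have "\<dots> \<le> K * (z * g 1) * pr q y + (1 - q) * (K * g 0 * pr q y) + 1 * (pr q y * D)"
      proof (intro add_mono)
        show "q * ?C True + (1 - q) * ?C False \<le> K * (z * g 1) * pr q y"
          using Y_coin[of 0] M by simp
        show "(1 - q) * X 0 y \<le> (1 - q) * (K * g 0 * pr q y)"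
          using q by (intro mult_left_mono X) auto
        \<comment> \<open>A state just synchronised has no coins and matches only
          \<open>y = []\<close>, where \<open>pr q y = 1\<close>.\<close>
        have "of_bool (y = []) * N \<le> pr q y * D"
          using N D prn[of y] by (cases "y = []") auto
        then show "(1 - q) * (of_bool (y = []) * N) \<le> 1 * (pr q y * D)"
          using q N D prn by (intro mult_mono) auto
      qed
      also have "\<dots> = (K * pr q y) * ((1 - q) + z * g 1) + D * g k * pr q y"
        using g 3 by (simp add: algebra_simps)
      also have "\<dots> \<le> (K * pr q y) * \<kappa> + D * g k * pr q y"
        using K prn g_0 by (intro add_right_mono mult_left_mono) auto
      finally show ?thesis using g 3 by (simp add: algebra_simps)
    qed
  qed
  have None: "expect n P' (\<lambda>ts. coin_weight z k y (None # ts)) = X k y"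
    unfolding X_def by (intro expect_cong) (simp add: coin_weight_def pop_def)
  have R: "0 \<le> K * g k * pr q y" "0 \<le> D * g k * pr q y"
    using K D g prn by auto
  have "expect (Suc n) P (coin_weight z k y) = (1 - e) * X k y + e * (q * Y True + (1 - q) * Y False)"
    unfolding expect_Suc_coin[where P = P, OF coin e_def] P'_def[symmetric] None Y_def ..
  also have "\<dots> \<le> (1 - e) * (K * g k * pr q y) + e * (\<kappa> * (K * g k * pr q y) + D * g k * pr q y)"
    using e01 by (intro add_mono mult_left_mono X k main) auto
  also have "\<dots> = (1 - e * (1 - \<kappa>)) * (K * g k * pr q y) + e * (D * g k * pr q y)"
    by (simp add: algebra_simps)
  also have "\<dots> \<le> (1 - \<delta> * (1 - \<kappa>)) * (K * g k * pr q y) + 1 * (D * g k * pr q y)"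
    using e01 lam R by (intro add_mono mult_right_mono) (auto intro!: mult_right_mono)
  finally show ?thesis
    by (simp add: algebra_simps)
qed

lemma unsync_rate:
  assumes "0 < \<delta>" "\<delta> \<le> 1"
  shows "0 \<le> 1 - \<delta> * ((1 - q) / 2) ^ M" "1 - \<delta> * ((1 - q) / 2) ^ M < 1"
proof -
  have "0 < ((1 - q) / 2) ^ M" "((1 - q) / 2) ^ M \<le> 1"
    using q by (auto intro!: power_le_one)
  then show "0 \<le> 1 - \<delta> * ((1 - q) / 2) ^ M" "1 - \<delta> * ((1 - q) / 2) ^ M < 1"
    using assms by (auto simp: mult_le_one)
qed

text \<open>\<open>gain\<close> says that one cycle, a read followed by storing \<open>M\<close>
  coins, multiplies the exponential moment by less than 1.\<close>

lemma expect_coins: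
  fixes z :: real
  assumes \<delta>: "0 < \<delta>" "\<delta> \<le> 1" and z: "0 < z" "z \<le> 1"
    and gain: "((1 / z) ^ r + q ^ r * (1 / z) ^ T) * z ^ M < 1"
  obtains K \<mu> where "0 \<le> K" "0 < \<mu>" "\<mu> < 1"
    "\<And>n P. good_law \<delta> P \<Longrightarrow> expect n P (coin_weight z 0 []) \<le> K * \<mu> ^ n"
proof -
  define \<zeta> where "\<zeta> = (1 / z) ^ r + q ^ r * (1 / z) ^ T"
  have \<zeta>: "0 \<le> \<zeta>" "\<zeta> * z ^ M < 1"
    using z q gain by (auto simp: \<zeta>_def)
  \<comment> \<open>Solving the conditions on \<open>g\<close> with equality from \<open>M\<close>
    down to 1 gives \<open>g k = A * w ^ (M - k)\<close>, and the condition at 0 becomes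
    \<open>f \<kappa> \<le> 0\<close>. It is strict at 1 by \<open>gain\<close>, hence by continuity
    at some \<open>\<kappa> < 1\<close>.\<close>
  define f where "f \<kappa> = (1 - q) + q * \<zeta> * (z / \<kappa>) ^ M - \<kappa>" for \<kappa> :: real
  have "isCont f 1"
    unfolding f_def by (intro continuous_intros) auto
  then have lim: "(f \<longlongrightarrow> f 1) (at_left 1)"
    using continuous_at_imp_continuous_within continuous_within by blast
  have "f 1 = q * (\<zeta> * z ^ M - 1)"
    by (simp add: f_def algebra_simps)
  then have "f 1 < 0"
    using \<zeta> q by (simp add: mult_pos_neg)
  with lim have "eventually (\<lambda>\<kappa>. f \<kappa> < 0) (at_left 1)"
    by (rule order_tendstoD)
  moreover have "eventually (\<lambda>\<kappa>. \<kappa> \<in> {0<..<1 :: real}) (at_left 1)"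
    by (rule eventually_at_leftI[of 0]) auto
  ultimately have "eventually (\<lambda>\<kappa>. f \<kappa> < 0 \<and> \<kappa> \<in> {0<..<1}) (at_left 1)"
    by eventually_elim simp
  then obtain \<kappa> where \<kappa>: "0 < \<kappa>" "\<kappa> < 1" "f \<kappa> < 0"
    using eventually_happens'[of "at_left (1::real)"] by (auto simp: trivial_limit_at_left_real)
  define w where "w = z / \<kappa>"
  define A where "A = q * \<zeta> / \<kappa>"
  define g where "g k = (if k = 0 then 1 else A * w ^ (M - k))" for k
  have w: "0 < w" "\<kappa> * w = z" and A: "0 \<le> A" "\<kappa> * A = q * \<zeta>"
    using \<kappa> z q \<zeta> by (auto simp: w_def A_def)
  have g: "0 \<le> g k" "g 0 = 1" for k
    using w A by (auto simp: g_def)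
  have g_M: "q * \<zeta> \<le> \<kappa> * g M"
    using M A by (simp add: g_def)
  have g_mid: "z * g (Suc k) \<le> \<kappa> * g k" if "0 < k" "k < M" for k
  proof -
    have "M - k = Suc (M - Suc k)"
      using that by simp
    then have "\<kappa> * g k = (\<kappa> * w) * (A * w ^ (M - Suc k))"
      using that by (simp add: g_def)
    then show ?thesis
      using w by (simp add: g_def)
  qed
  have g_0: "(1 - q) + z * g 1 \<le> \<kappa>"
  proof -
    have "z * g 1 = (\<kappa> * A) * (w * w ^ (M - 1))"
      using w(2)[symmetric] by (simp add: g_def)
    also have "w * w ^ (M - 1) = w ^ M"
      using M by (cases M) auto
    finally show ?thesis
      using \<kappa>(3) A by (simp add: f_def w_def)
  qed
  have "1 - \<delta> * (1 - \<kappa>) < 1"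
    using \<delta> \<kappa> by simp
  then obtain \<mu> where \<mu>: "0 < \<mu>" "\<mu> < 1" "1 - \<delta> * (1 - \<kappa>) < \<mu>" "1 - \<delta> * ((1 - q) / 2) ^ M \<le> \<mu>"
    using unsync_rate(2)[OF \<delta>] geometric_gap by blast
  \<comment> \<open>Fixed point: the bound \<open>K * \<mu> ^ n\<close> reproduces itself under the
    contraction plus the forcing \<open>2 * \<mu> ^ n\<close> from unsynchronised counters.\<close>
  define K where "K = 2 / (\<mu> - (1 - \<delta> * (1 - \<kappa>)))"
  have K: "0 \<le> K" "(1 - \<delta> * (1 - \<kappa>)) * K + 2 = \<mu> * K"
    using \<mu> by (auto simp: K_def field_simps)
  have main: "expect n P (coin_weight z k y) \<le> K * \<mu> ^ n * g k * pr q y"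
    if "good_law \<delta> P" "k \<le> M" for n P k y
    using that
  proof (induction n arbitrary: P k y)
    case 0
    then show ?case
      using M K \<mu> g pr_nonneg[of q y] q by (simp add: coin_weight_def)
  next
    case (Suc n)
    have "expect (Suc n) P (coin_weight z k y) \<le>
      ((1 - \<delta> * (1 - \<kappa>)) * (K * \<mu> ^ n) + 2 * \<mu> ^ n) * g k * pr q y"
    proof (rule expect_coins_step[where P = P and g = g and K = "K * \<mu> ^ n" and D = "2 * \<mu> ^ n", OF z _ _ \<delta>(1) g])
      show "coin_law (P 0)" "\<delta> \<le> 1 - pmf (P 0) None"
        using Suc.prems by (auto simp: good_law_def)
      show "q * ((1 / z) ^ r + q ^ r * (1 / z) ^ T) \<le> \<kappa> * g M"
        using g_M by (simp add: \<zeta>_def)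
      show "expect n (\<lambda>i. P (Suc i)) (coin_weight z k y) \<le> K * \<mu> ^ n * g k * pr q y" if "k \<le> M" for k y
        using Suc.IH[OF good_law_Suc[OF Suc.prems(1)] that] .
      have "expect n (\<lambda>i. P (Suc i)) (\<lambda>ts. of_bool (M < ctl (run ts))) \<le> 2 * (1 - \<delta> * ((1 - q) / 2) ^ M) ^ n"
        by (rule expect_unsync[OF \<delta> good_law_Suc[OF Suc.prems(1)]])
      also have "\<dots> \<le> 2 * \<mu> ^ n"
        using \<mu> unsync_rate[OF \<delta>] by (intro mult_left_mono power_mono) auto
      finally show "expect n (\<lambda>i. P (Suc i)) (\<lambda>ts. of_bool (M < ctl (run ts))) \<le> 2 * \<mu> ^ n" .
    qed (use g_mid g_0 K \<mu> \<kappa> Suc.prems in auto)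
    also have "(1 - \<delta> * (1 - \<kappa>)) * (K * \<mu> ^ n) + 2 * \<mu> ^ n = ((1 - \<delta> * (1 - \<kappa>)) * K + 2) * \<mu> ^ n"
      by (simp add: algebra_simps)
    also have "\<dots> = K * \<mu> ^ Suc n"
      unfolding K by simp
    finally show ?case .
  qed
  show ?thesis
    using that[OF K(1) \<mu>(1,2)] main[of _ 0 _ "[]"] g by simp
qed

section \<open>Exponentially small probability of a missing output\<close>

lemma decode_outs:
  fixes z y :: real
  assumes z: "0 < z" "z \<le> 1" and y: "0 < y"
  shows "y ^ length (snd (decode U B)) \<le> y ^ L * y ^ length B + (1 / z) ^ T * z ^ length U"
proof (cases "read_leaf U []")
  case None
  \<comment> \<open>A read fails only on at most \<open>T\<close> coins, so the weight 1 of the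
    emptied output stack is charged to the coin moment.\<close>
  have "z ^ 0 \<le> (1 / z) ^ T * z ^ length U"
    using z read_leaf_None_short(1)[OF None] by (intro power_length_diff) auto
  moreover have "0 \<le> y ^ L * y ^ length B"
    using y by simp
  ultimately show ?thesis
    using None by (simp add: decode_def)
next
  case (Some a)
  then obtain l U' where l: "read_leaf U [] = Some (l, U')"
    by (cases a) auto
  then show ?thesis
    using read_leaf_SomeD[OF l] z by (simp add: decode_def length_dec power_add)
qed

lemma expect_no_output:
  fixes z :: real
  assumes \<delta>: "0 < \<delta>" "\<delta> \<le> 1" and z: "0 < z" "z \<le> 1"
    and gain_coins: "((1 / z) ^ r + q ^ r * (1 / z) ^ T) * z ^ M < 1"
    and gain_bits: "(1 - \<delta> * q / 4) ^ L * (1 / (1 - q / 2)) ^ M \<le> 1 / 2"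
  obtains \<mu> K where "0 < \<mu>" "\<mu> < 1"
    "\<forall>n P. good_law \<delta> P \<longrightarrow> expect n P (\<lambda>ts. of_bool (outs (run ts) = [])) \<le> K * \<mu> ^ n"
proof -
  \<comment> \<open>Each stored coin multiplies \<open>a ^ k\<close> by exactly
    \<open>\<nu>\<close>, and \<open>\<nu> = (1 - q) + q / 2\<close> is also the mean factor of a
    coin at an idle step, as a read gains \<open>1 / 2\<close>. \<open>y\<close> is so close to 1
    that the pop, which costs \<open>1 / y\<close>, leaves \<open>\<eta> < 1\<close>.\<close>
  define \<nu> where "\<nu> = 1 - q / 2"
  define a where "a = 1 / \<nu>"
  define y where "y = 1 - \<delta> * q / 4"
  have \<nu>: "0 < \<nu>" "\<nu> < 1" and a: "1 \<le> a" "\<nu> * a = 1"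
    using q by (auto simp: \<nu>_def a_def)
  have \<delta>q: "0 < \<delta> * q" "\<delta> * q \<le> 1"
    using \<delta> q by (auto intro: mult_le_one)
  have y: "0 < y" "y < 1"
    using \<delta>q by (auto simp: y_def)
  have gain: "y ^ L * a ^ M \<le> 1 / 2"
    using gain_bits by (simp add: y_def a_def \<nu>_def)
  define V where "V \<sigma> = (if ctl \<sigma> \<le> M then a ^ ctl \<sigma> * y ^ length (outs \<sigma>) else 0)" for \<sigma> :: state
  have V_nonneg: "0 \<le> V \<sigma>" for \<sigma>
    using a y by (simp add: V_def)
  define \<eta> where "\<eta> = (1 - \<delta> * (1 - \<nu>)) / y"
  have \<eta>: "0 < \<eta>" "\<eta> < 1"
    using y \<delta>q by (auto simp: \<eta>_def \<nu>_def y_def field_simps)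
  define A where "A = a ^ M * (1 / z) ^ T"
  have A: "0 \<le> A"
    using a z by (simp add: A_def)
  \<comment> \<open>The two error terms are failed reads, controlled by the coin moment at counter
    0, and mass just synchronised, where \<open>V \<le> 1\<close>.\<close>
  have step: "(1 - e) * V (run (None # ts)) + e * (q * V (run (Some True # ts)) + (1 - q) * V (run (Some False # ts)))
      \<le> \<eta> * V (run ts) + (A * coin_weight z 0 [] ts + of_bool (M < ctl (run ts)))"
    if e: "\<delta> \<le> e" "e \<le> 1" for e ts
  proof -
    obtain k U B where run: "run ts = (k, U, B)"
      by (metis prod.collapse)
    have e0: "0 \<le> e" using e \<delta> by simp
    show ?thesis
    proof (cases "k \<le> M")
      case k: True
      define W where "W = a ^ k * y ^ length (tl B)"
      have W0: "0 \<le> W" using a y by (simp add: W_def)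
      have "y * y ^ length (tl B) \<le> y ^ length B"
        using y by (cases B) auto
      then have "a ^ k * (y * y ^ length (tl B)) \<le> a ^ k * y ^ length B"
        using a by (intro mult_left_mono) auto
      then have W_V: "W \<le> V (run ts) / y"
        using y k run by (simp add: V_def W_def field_simps)
      have None: "V (run (None # ts)) = W"
        using k by (simp add: V_def W_def pop_def run)
      define C where "C = A * coin_weight z 0 [] ts"
      have C: "0 \<le> C"
        using A z by (simp add: C_def coin_weight_nonneg)
      have "q * V (run (Some True # ts)) + (1 - q) * V (run (Some False # ts)) \<le> \<nu> * W + C"
      proof (cases "k = 0")
        case True
        have "V (run (Some True # ts)) = a ^ M * y ^ length (snd (decode U (tl B)))"
          using True by (simp add: V_def pop_def run)
        also have "\<dots> \<le> a ^ M * (y ^ L * y ^ length (tl B) + (1 / z) ^ T * z ^ length U)"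
          using a by (intro mult_left_mono decode_outs z y) auto
        also have "\<dots> = (y ^ L * a ^ M) * W + C"
          using True run by (simp add: W_def C_def A_def coin_weight_def algebra_simps)
        also have "\<dots> \<le> 1 / 2 * W + C"
          using gain W0 by (intro add_mono mult_right_mono) auto
        finally have "q * V (run (Some True # ts)) \<le> q * (1 / 2 * W + C)"
          using q by (intro mult_left_mono) auto
        moreover have "q * C \<le> 1 * C"
          using q C by (intro mult_right_mono) auto
        moreover have "V (run (Some False # ts)) = W"
          using True by (simp add: V_def W_def pop_def run)
        ultimately show ?thesis
          by (simp add: \<nu>_def algebra_simps)
      next
        case False
        then have "V (run (Some s # ts)) = a ^ (k - 1) * y ^ length (tl B)" for s
          using k by (simp add: V_def pop_def run)
        moreover have "\<nu> * W = (\<nu> * a) * a ^ (k - 1) * y ^ length (tl B)"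
          using False by (cases k) (auto simp: W_def)
        ultimately have "V (run (Some s # ts)) = \<nu> * W" for s
          using a by simp
        then show ?thesis
          using C by (simp add: algebra_simps)
      qed
      then have "(1 - e) * V (run (None # ts)) + e * (q * V (run (Some True # ts)) + (1 - q) * V (run (Some False # ts)))
        \<le> (1 - e) * W + e * (\<nu> * W + C)"
        unfolding None using e0 by (intro add_left_mono mult_left_mono) auto
      also have "\<dots> = (1 - e * (1 - \<nu>)) * W + e * C"
        by (simp add: algebra_simps)
      also have "\<dots> \<le> (1 - \<delta> * (1 - \<nu>)) * W + 1 * C"
        using e \<nu> W0 C by (intro add_mono mult_right_mono) (auto intro!: mult_right_mono)
      also have "\<dots> \<le> (1 - \<delta> * (1 - \<nu>)) * (V (run ts) / y) + 1 * C"
        using W_V \<eta> y by (intro add_mono mult_left_mono) (auto simp: \<eta>_def zero_less_divide_iff)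
      finally show ?thesis
        using k run by (simp add: C_def \<eta>_def)
    next
      case False
      then have [simp]: "B = []" "U = []"
        using unsync_empty[of ts] run by auto
      have "V (run (None # ts)) = 0" "V (run (Some True # ts)) = 0" "V (run (Some False # ts)) \<le> 1"
        using False M by (auto simp: V_def pop_def run)
      moreover from this have "e * ((1 - q) * V (run (Some False # ts))) \<le> 1 * (1 * 1)"
        using e e0 q V_nonneg by (intro mult_mono) auto
      ultimately show ?thesis
        using False run by (simp add: V_def coin_weight_def)
    qed
  qed
  obtain K1 \<mu>1 where K1: "0 \<le> K1" "0 < \<mu>1" "\<mu>1 < 1"
    "\<And>n P. good_law \<delta> P \<Longrightarrow> expect n P (coin_weight z 0 []) \<le> K1 * \<mu>1 ^ n"
    using expect_coins[OF \<delta> z gain_coins] by blast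
  define \<mu>0 where "\<mu>0 = 1 - \<delta> * ((1 - q) / 2) ^ M"
  have \<mu>0: "0 \<le> \<mu>0" "\<mu>0 < 1"
    using unsync_rate[OF \<delta>] by (auto simp: \<mu>0_def)
  obtain \<mu> where \<mu>: "0 < \<mu>" "\<mu> < 1" "\<eta> < \<mu>" "max \<mu>0 \<mu>1 \<le> \<mu>"
    using geometric_gap[of \<eta> "max \<mu>0 \<mu>1"] \<eta> \<mu>0 K1 by auto
  have unsync: "expect n P (\<lambda>ts. of_bool (M < ctl (run ts))) \<le> 2 * \<mu> ^ n" if "good_law \<delta> P" for n P
  proof -
    have "2 * \<mu>0 ^ n \<le> 2 * \<mu> ^ n"
      using \<mu> \<mu>0 by (intro mult_left_mono power_mono) auto
    with expect_unsync[OF \<delta> that, of n] show ?thesis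
      by (simp add: \<mu>0_def)
  qed
  have coins: "expect n P (coin_weight z 0 []) \<le> K1 * \<mu> ^ n" if "good_law \<delta> P" for n P
  proof -
    have "K1 * \<mu>1 ^ n \<le> K1 * \<mu> ^ n"
      using \<mu> K1 by (intro mult_left_mono power_mono) auto
    with K1(4)[OF that, of n] show ?thesis
      by linarith
  qed
  define D where "D = A * K1 + 2"
  define K where "K = D / (\<mu> - \<eta>)"
  have K: "\<eta> * K + D = \<mu> * K" "0 \<le> K"
    using \<mu> A K1 by (auto simp: K_def D_def field_simps)
  have EV: "expect n P (\<lambda>ts. V (run ts)) \<le> K * \<mu> ^ n" if "good_law \<delta> P" for n P
    using that
  proof (induction n arbitrary: P)
    case 0
    then show ?case using M K by (simp add: V_def)
  next
    case (Suc n)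
    let ?P = "\<lambda>i. P (Suc i)"
    note good = good_law_Suc[OF Suc.prems]
    have "expect (Suc n) P (\<lambda>ts. V (run ts)) \<le>
      expect n ?P (\<lambda>ts. \<eta> * V (run ts) + (A * coin_weight z 0 [] ts + of_bool (M < ctl (run ts))))"
      by (rule expect_Suc_le[OF _ refl step]) (use Suc.prems in \<open>auto simp: good_law_def pmf_le_1\<close>)
    also have "\<dots> \<le> \<eta> * (K * \<mu> ^ n) + (A * (K1 * \<mu> ^ n) + 2 * \<mu> ^ n)"
      unfolding expect_add expect_cmult
      using \<eta> A by (intro add_mono mult_left_mono Suc.IH[OF good] coins[OF good] unsync[OF good]) auto
    also have "\<dots> = (\<eta> * K + D) * \<mu> ^ n"
      by (simp add: D_def algebra_simps)
    also have "\<dots> = K * \<mu> ^ Suc n"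
      unfolding K by simp
    finally show ?case .
  qed
  have "expect n P (\<lambda>ts. of_bool (outs (run ts) = [])) \<le> (K + 2) * \<mu> ^ n" if "good_law \<delta> P" for n P
  proof -
    \<comment> \<open>With an empty output stack a synchronised state has
      \<open>V = a ^ k \<ge> 1\<close>.\<close>
    have "expect n P (\<lambda>ts. of_bool (outs (run ts) = [])) \<le> expect n P (\<lambda>ts. V (run ts) + of_bool (M < ctl (run ts)))"
      by (rule expect_mono) (use a y in \<open>auto simp: V_def one_le_power\<close>)
    also have "\<dots> \<le> K * \<mu> ^ n + 2 * \<mu> ^ n"
      unfolding expect_add by (intro add_mono EV unsync that)
    finally show ?thesis
      by (simp add: algebra_simps)
  qed
  then show ?thesis
    using that \<mu> by blast
qed

end

section \<open>A block code\<close>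

locale block_code =
  fixes q :: real and r J :: nat
  assumes q: "0 < q" "q < 1" and r_less_J: "r < J"
begin

section \<open>The law of the block indicators\<close>

definition special :: "bool list" where
  "special = replicate J True @ replicate J False"

definition bias :: real where
  "bias = q ^ J * (1 - q) ^ J"

lemma pr_special: "pr q special = bias"
  by (simp add: special_def bias_def)

lemma bias: "0 < bias" "bias < 1"
proof -
  show "0 < bias"
    using q by (simp add: bias_def)
  have "q ^ J * (1 - q) ^ J \<le> q ^ J * 1"
    using q by (intro mult_left_mono power_le_one) auto
  also have "q ^ J < 1"
    using q r_less_J by (simp add: power_less_one_iff)
  finally show "bias < 1"
    by (simp add: bias_def)
qed

primrec blocks :: "nat \<Rightarrow> bool list \<Rightarrow> bool list" where
  "blocks 0 w = []"
| "blocks (Suc n) w = (take (2 * J) w = special) # blocks n (drop (2 * J) w)"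

lemma length_blocks [simp]: "length (blocks n w) = n"
  by (induction n arbitrary: w) auto

lemma blocks_law:
  "length b = n \<Longrightarrow> (\<Sum>w | length w = 2 * J * n. of_bool (blocks n w = b) * pr q w) = pr bias b"
proof (induction b arbitrary: n)
  case Nil
  have "{w :: bool list. length w = 0} = {[]}"
    by auto
  then show ?case using Nil by simp
next
  case (Cons x b)
  then obtain m where n: "n = Suc m" "length b = m"
    by (cases n) auto
  have len: "length special = 2 * J"
    by (simp add: special_def)
  have yes: "(\<Sum>u | length u = 2 * J. of_bool (u = special) * pr q u) = bias"
  proof -
    have "(\<Sum>u | length u = 2 * J. of_bool (u = special) * pr q u) =
      (\<Sum>u | length u = 2 * J. if u = special then pr q u else 0)"
      by (intro sum.cong) auto
    also have "\<dots> = pr q special"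
      by (subst sum.delta) (auto simp: len)
    finally show ?thesis by (simp add: pr_special)
  qed
  have no: "(\<Sum>u | length u = 2 * J. of_bool (u \<noteq> special) * pr q u) = 1 - bias"
  proof -
    have "(\<Sum>u | length u = 2 * J. of_bool (u \<noteq> special) * pr q u) =
      (\<Sum>u | length u = 2 * J. pr q u - of_bool (u = special) * pr q u)"
      by (intro sum.cong) auto
    then show ?thesis
      by (simp add: sum_subtractf yes sum_pr)
  qed
  have split: "2 * J * n = 2 * J + 2 * J * m"
    using n by simp
  have "(\<Sum>w | length w = 2 * J * n. of_bool (blocks n w = x # b) * pr q w) =
    (\<Sum>u | length u = 2 * J. \<Sum>v | length v = 2 * J * m. of_bool (blocks n (u @ v) = x # b) * pr q (u @ v))"
    unfolding split by (rule sum_lists_append)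
  also have "\<dots> = (\<Sum>u | length u = 2 * J. \<Sum>v | length v = 2 * J * m.
      (of_bool ((u = special) = x) * pr q u) * (of_bool (blocks m v = b) * pr q v))"
    by (intro sum.cong refl) (auto simp: n)
  also have "\<dots> = (\<Sum>u | length u = 2 * J. of_bool ((u = special) = x) * pr q u) *
      (\<Sum>v | length v = 2 * J * m. of_bool (blocks m v = b) * pr q v)"
    by (simp only: sum_product)
  also have "\<dots> = pr bias (x # b)"
    using yes no Cons.IH[OF n(2)] by (cases x) auto
  finally show ?case .
qed

text \<open>
  A word whose first special block is block \<open>l\<close> is recoded by moving this block to the front and
  replacing it by $T^r$ followed by \<open>arrangement l\<close>, which has the same number of heads and remembers \<open>l\<close>.
\<close>

definition arrangement :: "nat \<Rightarrow> bool list" where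
  "arrangement l = replicate l False @ replicate (J - r) True @ replicate (J - l) False"

lemma length_arrangement: "l \<le> J \<Longrightarrow> length (arrangement l) = 2 * J - r"
  using r_less_J by (simp add: arrangement_def)

lemma pr_arrangement: "l \<le> J \<Longrightarrow> q ^ r * pr q (arrangement l) = bias"
  using r_less_J by (simp add: arrangement_def bias_def flip: power_add mult.assoc)
    (simp add: mult.assoc mult.left_commute flip: power_add)

text \<open>Since \<open>r < J\<close> the run of heads is nonempty, so it marks the end of the
  leading tails; this makes the recoding invertible.\<close>

lemma arrangement_index: "length (takeWhile Not (arrangement l)) = l"
proof -
  obtain j where "J - r = Suc j"
    using r_less_J by (metis Suc_diff_Suc)
  then show ?thesis
    by (simp add: arrangement_def takeWhile_append)
qed

text \<open>Inverts the recoding: \<open>z\<close> gives the position \<open>l\<close> of the first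
  special block and \<open>b\<close> the indicators of the other \<open>J - 1\<close> blocks. Words
  that are not images of the recoding yield the all-\<open>False\<close> output.\<close>

definition decode_tail :: "bool list \<Rightarrow> bool list" where
  "decode_tail t =
    (let z = take (2 * J - r) t; b = blocks (J - 1) (drop (2 * J - r) t); l = length (takeWhile Not z)
     in if l < J \<and> z = arrangement l \<and> take l b = replicate l False
        then replicate l False @ True # drop l b else replicate J False)"

abbreviation depth :: nat where "depth \<equiv> 2 * J * J"

definition short_leaves :: "bool list set" where
  "short_leaves = (\<lambda>i. replicate i True @ [False]) ` {..<r}"

definition long_leaves :: "bool list set" where
  "long_leaves = (\<lambda>t. replicate r True @ t) ` {t. length t = depth - r}"

definition leaf_value :: "bool list \<Rightarrow> bool list" where
  "leaf_value w = (if length w \<le> r then replicate J False else decode_tail (drop r w))"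

lemma r_less_depth: "r < depth"
proof -
  have "1 * J \<le> (2 * J) * J"
    using r_less_J by (intro mult_right_mono) auto
  then show ?thesis
    using r_less_J by linarith
qed

lemma depth_split: "depth - r = (2 * J - r) + 2 * J * (J - 1)"
  using r_less_J by (cases J) auto

lemma length_decode_tail: "length (decode_tail t) = J"
  by (auto simp: decode_tail_def Let_def)

lemma decode_tail_eq_iff:
  assumes u: "length u = 2 * J - r" and v: "v = replicate l False @ True # v'" "length v = J"
  shows "decode_tail (u @ w) = v \<longleftrightarrow> u = arrangement l \<and> blocks (J - 1) w = replicate l False @ v'"
proof -
  have l: "l < J" using v by simp
  have inj: "m = l \<and> x = v'" if "replicate m False @ True # x = replicate l False @ True # v'" for m x
  proof -
    have "m = l"
      using arg_cong[OF that, of "\<lambda>xs. length (takeWhile Not xs)"] by (simp add: takeWhile_append)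
    with that show ?thesis by simp
  qed
  have ne: "replicate J False \<noteq> v"
    unfolding v(1) by (metis in_set_conv_decomp in_set_replicate)
  show ?thesis
  proof
    assume "decode_tail (u @ w) = v"
    moreover define m where "m = length (takeWhile Not u)"
    moreover define b where "b = blocks (J - 1) w"
    ultimately have *: "u = arrangement m" "take m b = replicate m False" "replicate m False @ True # drop m b = v"
      using ne u by (auto simp: decode_tail_def Let_def split: if_splits)
    with inj[of m "drop m b"] v(1) have "m = l" "drop m b = v'"
      by auto
    moreover have "b = take m b @ drop m b" by simp
    ultimately show "u = arrangement l \<and> blocks (J - 1) w = replicate l False @ v'"
      using * by (simp add: b_def)
  next
    assume "u = arrangement l \<and> blocks (J - 1) w = replicate l False @ v'"
    then show "decode_tail (u @ w) = v"
      using u l v by (simp add: decode_tail_def Let_def arrangement_index)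
  qed
qed

text \<open>The \<open>r\<close> forced heads and the arrangement together weigh
  \<open>bias\<close>, as much as the special block they replace; the other \<open>J - 1\<close>
  blocks keep their law.\<close>

lemma decode_tail_law:
  assumes v: "v = replicate l False @ True # v'" "length v = J"
  shows "q ^ r * (\<Sum>t | length t = depth - r. of_bool (decode_tail t = v) * pr q t) = pr bias v"
proof -
  have l: "l \<le> J" "length (replicate l False @ v') = J - 1"
    using v by auto
  have "(\<Sum>t | length t = depth - r. of_bool (decode_tail t = v) * pr q t) =
    (\<Sum>u | length u = 2 * J - r. \<Sum>w | length w = 2 * J * (J - 1). of_bool (decode_tail (u @ w) = v) * pr q (u @ w))"
    unfolding depth_split by (rule sum_lists_append)
  also have "\<dots> = (\<Sum>u | length u = 2 * J - r. \<Sum>w | length w = 2 * J * (J - 1).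
      (of_bool (u = arrangement l) * pr q u) * (of_bool (blocks (J - 1) w = replicate l False @ v') * pr q w))"
    by (intro sum.cong refl) (auto simp: decode_tail_eq_iff[OF _ v])
  also have "\<dots> = (\<Sum>u | length u = 2 * J - r. of_bool (u = arrangement l) * pr q u) *
     (\<Sum>w | length w = 2 * J * (J - 1). of_bool (blocks (J - 1) w = replicate l False @ v') * pr q w)"
    by (simp only: sum_product)
  also have "(\<Sum>u | length u = 2 * J - r. of_bool (u = arrangement l) * pr q u) =
      (\<Sum>u | length u = 2 * J - r. if u = arrangement l then pr q u else 0)"
    by (intro sum.cong) auto
  also have "\<dots> = pr q (arrangement l)"
    by (subst sum.delta) (auto simp: length_arrangement l)
  finally show ?thesis
    using blocks_law[OF l(2)] pr_arrangement[OF l(1)] by (simp add: v(1) mult.assoc[symmetric])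
qed

section \<open>The code tree and its output law\<close>

lemma finite_leaves: "finite short_leaves" "finite long_leaves"
  by (auto simp: short_leaves_def long_leaves_def)

lemma leaves_disjoint: "short_leaves \<inter> long_leaves = {}"
  using r_less_depth by (auto simp: short_leaves_def long_leaves_def dest!: arg_cong[of _ _ length])

lemma sum_long_leaves: "sum f long_leaves = (\<Sum>t | length t = depth - r. f (replicate r True @ t))"
  unfolding long_leaves_def by (subst sum.reindex) (auto simp: inj_on_def)

lemma sum_pr_short: "(\<Sum>w\<in>short_leaves. pr q w) = 1 - q ^ r"
proof -
  have "inj_on (\<lambda>i. replicate i True @ [False]) {..<r}"
    by (auto simp: inj_on_def)
  then have "(\<Sum>w\<in>short_leaves. pr q w) = (\<Sum>i<r. q ^ i) * (1 - q)"
    unfolding short_leaves_def by (subst sum.reindex) (auto simp: sum_distrib_right)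
  then show ?thesis
    by (simp add: one_diff_power_eq mult.commute)
qed

lemma sum_pr_long: "(\<Sum>w\<in>long_leaves. pr q w) = q ^ r"
  unfolding sum_long_leaves by (simp add: sum_pr flip: sum_distrib_left)

lemma length_leaf_value: "w \<in> short_leaves \<union> long_leaves \<Longrightarrow> length (leaf_value w) = J"
  by (auto simp: leaf_value_def length_decode_tail)

text \<open>Outputs containing \<open>True\<close> come from long leaves only and are given by
  \<open>decode_tail_law\<close>. The all-\<open>False\<close> output, which collects everything
  else, follows by subtraction because both sides have total mass 1.\<close>

lemma leaf_value_law:
  assumes "length v = J"
  shows "(\<Sum>w | w \<in> short_leaves \<union> long_leaves \<and> leaf_value w = v. pr q w) = pr bias v"
proof -
  let ?Z = "replicate J False"
  define S where "S v = (\<Sum>w | w \<in> short_leaves \<union> long_leaves \<and> leaf_value w = v. pr q w)" for v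
  have nonzero: "S v = pr bias v" if "length v = J" "v \<noteq> ?Z" for v
  proof -
    have "True \<in> set v"
      using that by (metis (full_types) replicate_eqI)
    then obtain xs v' where xs: "v = xs @ True # v'" "True \<notin> set xs"
      by (metis split_list_first)
    have "xs = replicate (length xs) False"
      using xs(2) by (metis (full_types) replicate_eqI)
    then obtain l where v: "v = replicate l False @ True # v'"
      using xs(1) by metis
    have "S v = (\<Sum>w\<in>short_leaves \<union> long_leaves. if leaf_value w = v then pr q w else 0)"
      unfolding S_def by (rule sum.inter_filter) (simp add: finite_leaves)
    also have "\<dots> = (\<Sum>w\<in>short_leaves. if leaf_value w = v then pr q w else 0) +
        (\<Sum>w\<in>long_leaves. if leaf_value w = v then pr q w else 0)"
      by (rule sum.union_disjoint) (simp_all add: finite_leaves leaves_disjoint)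
    also have "(\<Sum>w\<in>short_leaves. if leaf_value w = v then pr q w else 0) = 0"
      by (rule sum.neutral) (use that in \<open>auto simp: short_leaves_def leaf_value_def\<close>)
    also have "(\<Sum>w\<in>long_leaves. if leaf_value w = v then pr q w else 0) =
        q ^ r * (\<Sum>t | length t = depth - r. of_bool (decode_tail t = v) * pr q t)"
      unfolding sum_long_leaves sum_distrib_left
      by (intro sum.cong refl) (use r_less_depth in \<open>auto simp: leaf_value_def\<close>)
    also have "\<dots> = pr bias v"
      by (rule decode_tail_law[OF v that(1)])
    finally show ?thesis by simp
  qed
  have "(\<Sum>v | length v = J. S v) = (\<Sum>w\<in>short_leaves \<union> long_leaves. pr q w)"
    unfolding S_def using length_leaf_value
    by (intro sum.group) (auto simp: finite_leaves)
  also have "\<dots> = 1"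
    by (subst sum.union_disjoint) (simp_all add: finite_leaves leaves_disjoint sum_pr_short sum_pr_long)
  also have "\<dots> = (\<Sum>v | length v = J. pr bias v)"
    by (simp add: sum_pr)
  finally have "S ?Z + (\<Sum>v\<in>{v. length v = J} - {?Z}. S v) = pr bias ?Z + (\<Sum>v\<in>{v. length v = J} - {?Z}. pr bias v)"
    by (subst (asm) (1 2) sum.remove[of _ ?Z]) auto
  moreover have "(\<Sum>v\<in>{v. length v = J} - {?Z}. S v) = (\<Sum>v\<in>{v. length v = J} - {?Z}. pr bias v)"
    by (intro sum.cong) (auto simp: nonzero)
  ultimately have "S ?Z = pr bias ?Z"
    by simp
  with nonzero assms show ?thesis
    unfolding S_def by metis
qed

lemma short_leaf:
  assumes "r \<le> length U" "\<not> prefix (replicate r True) U"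
  shows "\<exists>w\<in>short_leaves. prefix w U"
proof -
  define i where "i = length (takeWhile id U)"
  have tw: "takeWhile id U = replicate i True"
    unfolding i_def by (intro replicate_eqI refl) (auto dest: set_takeWhileD)
  have U: "U = replicate i True @ dropWhile id U"
    using takeWhile_dropWhile_id[of id U] tw by simp
  have "i < r"
  proof (rule ccontr)
    assume "\<not> i < r"
    then have "replicate i True = replicate r True @ replicate (i - r) True"
      by (simp flip: replicate_add)
    with U have "prefix (replicate r True) U"
      by (metis append_assoc prefixI)
    with assms show False by simp
  qed
  moreover obtain x xs where dw: "dropWhile id U = x # xs"
    using U assms \<open>i < r\<close> by (cases "dropWhile id U") (metis append_Nil2 length_replicate not_le)
  moreover from dw have "x = False"
    using hd_dropWhile[of id U] by simp
  ultimately show ?thesis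
    using U by (intro bexI[of _ "replicate i True @ [False]"]) (auto simp: short_leaves_def prefix_def)
qed

lemma stack_coding:
  assumes "0 < M"
  shows "stack_coding q bias r J M depth (short_leaves \<union> long_leaves) leaf_value"
proof
  fix w assume "w \<in> short_leaves \<union> long_leaves"
  then show "length (leaf_value w) = J" "length w \<le> r \<or> length w = depth \<and> prefix (replicate r True) w"
    using r_less_depth length_leaf_value by (auto simp: short_leaves_def long_leaves_def)
next
  fix v :: "bool list" assume "length v = J"
  then show "(\<Sum>w | w \<in> short_leaves \<union> long_leaves \<and> leaf_value w = v. pr q w) \<le> pr bias v"
    using leaf_value_law by simp
next
  have "{w \<in> short_leaves \<union> long_leaves. r < length w} = long_leaves"
    using r_less_depth by (auto simp: short_leaves_def long_leaves_def)
  then show "(\<Sum>w | w \<in> short_leaves \<union> long_leaves \<and> r < length w. pr q w) \<le> q ^ r"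
    by (simp add: sum_pr_long)
next
  fix U :: "bool list" assume U: "depth \<le> length U"
  show "\<exists>w\<in>short_leaves \<union> long_leaves. prefix w U"
  proof (cases "prefix (replicate r True) U")
    case True
    then obtain X where X: "U = replicate r True @ X"
      by (auto simp: prefix_def)
    then have "replicate r True @ take (depth - r) X \<in> long_leaves"
      using U by (auto simp: long_leaves_def)
    moreover have "prefix (replicate r True @ take (depth - r) X) U"
      by (simp add: X take_is_prefix)
    ultimately show ?thesis by blast
  qed (use short_leaf[of U] U r_less_depth in auto)
qed (use q bias assms r_less_depth short_leaf in \<open>auto simp: finite_leaves\<close>)

end

section \<open>The factor map\<close>

lemma space_bernoulli [simp]: "space (bernoulli_measure p) = UNIV"
  by (auto simp: bernoulli_measure_def space_PiM)

lemma space_seq_space [simp]: "space seq_space = UNIV"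
  by (auto simp: seq_space_def space_PiM)

lemma sets_bernoulli [measurable_cong]: "sets (bernoulli_measure p) = sets seq_space"
  unfolding bernoulli_measure_def seq_space_def by (intro sets_PiM_cong) auto

lemma prob_space_bernoulli: "prob_space (bernoulli_measure p)"
  unfolding bernoulli_measure_def by (intro prob_space_PiM prob_space_measure_pmf)

lemma measure_bernoulli_cylinder:
  assumes "finite J"
  shows "measure (bernoulli_measure p) {x. \<forall>k\<in>J. x k \<in> X k} = (\<Prod>k\<in>J. measure_pmf.prob (p k) (X k))"
proof -
  interpret P: product_prob_space "\<lambda>n. measure_pmf (p n)" UNIV
    by unfold_locales
  have "{x. \<forall>k\<in>J. x k \<in> X k} = prod_emb UNIV (\<lambda>n. measure_pmf (p n)) J (Pi\<^sub>E J X)"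
    by (auto simp: prod_emb_def PiE_iff)
  then show ?thesis
    unfolding bernoulli_measure_def using P.measure_PiM_emb[of J X] assms by simp
qed

definition window :: "('a \<Rightarrow> 't) \<Rightarrow> (nat \<Rightarrow> 'a) \<Rightarrow> nat \<Rightarrow> nat \<Rightarrow> 't list" where
  "window g x i n = map (\<lambda>j. g (x (i + j))) [0..<n]"

lemma length_window [simp]: "length (window g x i n) = n"
  by (simp add: window_def)

lemma window_Suc: "window g x i (Suc n) = g (x i) # window g x (Suc i) n"
  unfolding window_def by (subst upt_conv_Cons) (simp_all add: map_Suc_upt[symmetric] del: upt_Suc)

lemma window_add: "window g x i (m + n) = window g x i m @ window g x (i + m) n"
  by (induction m arbitrary: i) (simp_all add: window_Suc, simp add: window_def)

lemma measurable_window [measurable]: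
  fixes g :: "'a \<Rightarrow> 't::finite"
  shows "(\<lambda>x. window g x i n) \<in> seq_space \<rightarrow>\<^sub>M count_space UNIV"
proof (induction n)
  case 0
  then show ?case by (simp add: window_def)
next
  case (Suc n)
  have c: "(\<lambda>x. x (i + n)) \<in> (seq_space :: (nat \<Rightarrow> 'a) measure) \<rightarrow>\<^sub>M count_space UNIV"
    unfolding seq_space_def by (rule measurable_component_singleton) simp
  have "(\<lambda>x. (\<lambda>l x. l @ [g (x (i + n))]) (window g x i n) x) \<in> seq_space \<rightarrow>\<^sub>M count_space UNIV"
  proof (rule measurable_compose_countable[OF _ Suc])
    fix l :: "'t list"
    show "(\<lambda>x. l @ [g (x (i + n))]) \<in> seq_space \<rightarrow>\<^sub>M count_space UNIV"
      using measurable_compose[OF c measurable_count_space[of "\<lambda>a. l @ [g a]"]] by simp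
  qed
  then show ?case
    by (simp add: window_def)
qed

lemma sets_window:
  fixes g :: "'a \<Rightarrow> 't::finite"
  shows "{x. window g x i n \<in> S} \<in> sets seq_space"
proof -
  have "(\<lambda>x. window g x i n) -` S \<inter> space seq_space \<in> sets seq_space"
    by (rule measurable_sets[OF measurable_window]) simp
  then show ?thesis
    by (simp add: vimage_def)
qed

lemma measure_window_eq_sum:
  fixes g :: "'a \<Rightarrow> 't::finite"
  assumes "prob_space M" "sets M = sets seq_space"
  shows "measure M {x. window g x i n \<in> S} = (\<Sum>ts | length ts = n \<and> ts \<in> S. measure M {x. window g x i n = ts})"
proof -
  interpret prob_space M by fact
  have fin: "finite {ts :: 't list. length ts = n \<and> ts \<in> S}"
    by (rule finite_subset[of _ "{ts. length ts = n}"]) auto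
  have "{x. window g x i n \<in> S} = (\<Union>ts\<in>{ts. length ts = n \<and> ts \<in> S}. {x. window g x i n = ts})"
    by auto
  also have "measure M \<dots> = (\<Sum>ts | length ts = n \<and> ts \<in> S. measure M {x. window g x i n = ts})"
  proof (rule finite_measure_finite_Union[OF fin])
    show "(\<lambda>ts. {x. window g x i n = ts}) ` {ts. length ts = n \<and> ts \<in> S} \<subseteq> events"
      using sets_window[of g i n "{ts}" for ts] assms by auto
  qed (auto simp: disjoint_family_on_def)
  finally show ?thesis .
qed

lemma measure_window:
  fixes g :: "'a \<Rightarrow> 't::finite"
  shows "measure (bernoulli_measure p) {x. window g x i n \<in> S} =
    expect n (\<lambda>j. map_pmf g (p (i + j))) (\<lambda>ts. of_bool (ts \<in> S))"
proof -
  have single: "measure (bernoulli_measure p) {x. window g x i n = ts} = (\<Prod>j<n. pmf (map_pmf g (p (i + j))) (ts ! j))"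
    if "length ts = n" for ts
  proof -
    have "window g x i n = ts \<longleftrightarrow> (\<forall>k\<in>{i..<i + n}. g (x k) = ts ! (k - i))" for x
    proof
      assume "window g x i n = ts"
      then show "\<forall>k\<in>{i..<i + n}. g (x k) = ts ! (k - i)"
        by (auto simp: window_def)
    next
      assume "\<forall>k\<in>{i..<i + n}. g (x k) = ts ! (k - i)"
      then show "window g x i n = ts"
        using that by (intro nth_equalityI) (auto simp: window_def)
    qed
    then have "{x. window g x i n = ts} = {x. \<forall>k\<in>{i..<i + n}. x k \<in> {a. g a = ts ! (k - i)}}"
      by simp
    then have "measure (bernoulli_measure p) {x. window g x i n = ts} =
      (\<Prod>k\<in>{i..<i + n}. measure_pmf.prob (p k) {a. g a = ts ! (k - i)})"
      by (simp only: measure_bernoulli_cylinder finite_atLeastLessThan)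
    also have "\<dots> = (\<Prod>j<n. pmf (map_pmf g (p (i + j))) (ts ! j))"
      by (rule prod.reindex_bij_witness[of _ "\<lambda>j. i + j" "\<lambda>k. k - i"]) (auto simp: pmf_map vimage_def)
    finally show ?thesis .
  qed
  have "measure (bernoulli_measure p) {x. window g x i n \<in> S} =
    (\<Sum>ts | length ts = n \<and> ts \<in> S. \<Prod>j<n. pmf (map_pmf g (p (i + j))) (ts ! j))"
    unfolding measure_window_eq_sum[OF prob_space_bernoulli sets_bernoulli] by (intro sum.cong refl single) simp
  also have "\<dots> = (\<Sum>ts\<in>{ts \<in> {ts. length ts = n}. ts \<in> S}. \<Prod>j<n. pmf (map_pmf g (p (i + j))) (ts ! j))"
    by simp
  also have "\<dots> = (\<Sum>ts | length ts = n. if ts \<in> S then \<Prod>j<n. pmf (map_pmf g (p (i + j))) (ts ! j) else 0)"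
    by (rule sum.inter_filter) simp
  also have "\<dots> = expect n (\<lambda>j. map_pmf g (p (i + j))) (\<lambda>ts. of_bool (ts \<in> S))"
    unfolding expect_eq_sum by (intro sum.cong refl) simp
  finally show ?thesis .
qed

text \<open>A cylinder depends on finitely many coordinates, hence is a finite union of events
  fixing one initial window.\<close>

lemma bernoulli_eqI:
  fixes \<alpha> :: "nat \<Rightarrow> 'b::finite pmf"
  assumes M: "prob_space M" "sets M = sets seq_space"
    and eq: "\<And>bs. measure M {x. window id x 0 (length bs) = bs} = measure (bernoulli_measure \<alpha>) {x. window id x 0 (length bs) = bs}"
  shows "M = bernoulli_measure \<alpha>"
  unfolding bernoulli_measure_def
proof (rule measure_eqI_PiM_infinite)
  interpret M: prob_space M by fact
  interpret B: prob_space "bernoulli_measure \<alpha>" by (rule prob_space_bernoulli)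
  show "sets M = sets (\<Pi>\<^sub>M n\<in>UNIV. measure_pmf (\<alpha> n))"
    using M(2) sets_bernoulli[of \<alpha>] by (simp add: bernoulli_measure_def)
  show "finite_measure M"
    by unfold_locales
  fix F :: "nat \<Rightarrow> 'b set" and J :: "nat set"
  assume "finite J"
  then obtain n where n: "J \<subseteq> {..<n}"
    by (meson finite_nat_bounded)
  define S where "S = {bs :: 'b list. \<forall>j\<in>J. bs ! j \<in> F j}"
  have nth: "window id x 0 n ! j = x j" if "j \<in> J" for x :: "nat \<Rightarrow> 'b" and j
    using that n by (auto simp: window_def)
  have cyl: "prod_emb UNIV (\<lambda>n. measure_pmf (\<alpha> n)) J (Pi\<^sub>E J F) = {x. window id x 0 n \<in> S}"
    by (auto simp: prod_emb_def PiE_iff S_def nth)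
  have "measure M {x. window id x 0 n \<in> S} = measure (bernoulli_measure \<alpha>) {x. window id x 0 n \<in> S}"
    unfolding measure_window_eq_sum[OF M] measure_window_eq_sum[OF prob_space_bernoulli sets_bernoulli]
    by (intro sum.cong refl) (use eq in auto)
  then show "emeasure M (prod_emb UNIV (\<lambda>n. measure_pmf (\<alpha> n)) J (Pi\<^sub>E J F)) =
      emeasure (\<Pi>\<^sub>M n\<in>UNIV. measure_pmf (\<alpha> n)) (prod_emb UNIV (\<lambda>n. measure_pmf (\<alpha> n)) J (Pi\<^sub>E J F))"
    unfolding cyl M.emeasure_eq_measure B.emeasure_eq_measure[unfolded bernoulli_measure_def]
    by (simp add: bernoulli_measure_def)
qed simp

section \<open>The limit map: equivariance and law\<close>

context stack_coding
begin

text \<open>If no window yields an output the value defaults to \<open>False\<close>; otherwise all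
  successful windows agree by \<open>outs_mono\<close>. Only letters from \<open>i\<close> on are
  inspected, so equivariance holds at every point.\<close>

definition factor :: "('a \<Rightarrow> bool option) \<Rightarrow> (nat \<Rightarrow> 'a) \<Rightarrow> nat \<Rightarrow> bool" where
  "factor g x i \<longleftrightarrow> (\<exists>n. outs (run (window g x i n)) \<noteq> [] \<and> hd (outs (run (window g x i n))))"

lemma factor_left_shift: "factor g (left_shift x) = left_shift (factor g x)"
proof
  fix i
  have "window g (left_shift x) i n = window g x (Suc i) n" for n
    by (simp add: window_def left_shift_def)
  then have "factor g (left_shift x) i = factor g x (Suc i)"
    by (simp only: factor_def)
  then show "factor g (left_shift x) i = left_shift (factor g x) i"
    by (simp only: left_shift_def)
qed

lemma measurable_factor: "factor g \<in> seq_space \<rightarrow>\<^sub>M seq_space"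
  unfolding seq_space_def[where 'a = bool]
proof (rule measurable_PiM_single')
  fix i :: nat
  have "{x. factor g x i} = (\<Union>n. {x. window g x i n \<in> {ts. outs (run ts) \<noteq> [] \<and> hd (outs (run ts))}})"
    by (auto simp: factor_def)
  also have "\<dots> \<in> sets seq_space"
    by (intro sets.countable_UN image_subsetI sets_window)
  finally have "{x. factor g x i} \<in> sets seq_space" .
  then show "(\<lambda>x. factor g x i) \<in> seq_space \<rightarrow>\<^sub>M count_space UNIV"
    by (simp add: pred_def)
qed auto

text \<open>Two successful windows of lengths \<open>m\<close> and \<open>n\<close> are compared
  inside the common extension of length \<open>m + n\<close>.\<close>

lemma factor_eq:
  assumes "outs (run (window g x i n)) \<noteq> []"
  shows "factor g x i = hd (outs (run (window g x i n)))"
proof -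
  have mono: "outs (run (window g x i (m + k))) \<noteq> [] \<and>
      hd (outs (run (window g x i (m + k)))) = hd (outs (run (window g x i m)))"
    if "outs (run (window g x i m)) \<noteq> []" for m k
    unfolding window_add using outs_mono[OF that, of "window g x (i + m) k"] by simp
  have same: "hd (outs (run (window g x i m))) = hd (outs (run (window g x i n)))"
    if "outs (run (window g x i m)) \<noteq> []" for m
    using mono[OF that, of n] mono[OF assms, of m] by (metis add.commute)
  show ?thesis
    unfolding factor_def using same assms by metis
qed

lemma emits_factor:
  assumes "length bs \<le> n" "\<And>j. j < length bs \<Longrightarrow> outs (run (window g x (i + j) (n - j))) \<noteq> []"
    and "window id (factor g x) i (length bs) = bs"
  shows "emits bs (window g x i n)"
  using assms
proof (induction bs arbitrary: i n)
  case (Cons b bs)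
  obtain m where n: "n = Suc m"
    using Cons.prems(1) by (cases n) auto
  have "emits bs (window g x (Suc i) m)"
  proof (rule Cons.IH)
    fix j assume "j < length bs"
    then show "outs (run (window g x (Suc i + j) (m - j))) \<noteq> []"
      using Cons.prems(2)[of "Suc j"] n by simp
  qed (use Cons.prems n in \<open>auto simp: window_Suc\<close>)
  moreover have "outs (run (window g x i n)) \<noteq> []"
    using Cons.prems(2)[of 0] by simp
  moreover from factor_eq[OF this] have "hd (outs (run (window g x i n))) = b"
    using Cons.prems(3) by (simp add: window_Suc)
  ultimately show ?case
    unfolding n by (simp add: window_Suc del: run.simps)
qed simp

text \<open>Either the outputs \<open>bs\<close> already appear in the window of length
  \<open>n\<close>, with probability at most \<open>pr \<alpha> bs\<close>, or one of finitely many
  windows lacks an output, with probability vanishing as \<open>n\<close> grows.\<close>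

lemma measure_factor_le:
  fixes p :: "nat \<Rightarrow> 'a pmf" and g :: "'a \<Rightarrow> bool option"
  assumes good: "\<And>i. good_law \<delta> (\<lambda>j. map_pmf g (p (i + j)))"
    and \<mu>: "0 < \<mu>" "\<mu> < 1"
    and starve: "\<And>n P. good_law \<delta> P \<Longrightarrow> expect n P (\<lambda>ts. of_bool (outs (run ts) = [])) \<le> K * \<mu> ^ n"
  shows "measure (bernoulli_measure p) {x. window id (factor g x) 0 (length bs) = bs} \<le> pr \<alpha> bs"
proof (rule LIMSEQ_le_const)
  interpret prob_space "bernoulli_measure p" by (rule prob_space_bernoulli)
  let ?m = "length bs"
  have "(\<lambda>n. \<mu> ^ (n - j)) \<longlonglongrightarrow> 0" for j
    by (rule LIMSEQ_offset[of _ j]) (simp add: LIMSEQ_power_zero \<mu> less_imp_le)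
  then show "(\<lambda>n. pr \<alpha> bs + (\<Sum>j<?m. K * \<mu> ^ (n - j))) \<longlonglongrightarrow> pr \<alpha> bs"
    by (auto intro!: tendsto_eq_intros)
  have bound: "prob {x. window id (factor g x) 0 ?m = bs} \<le> pr \<alpha> bs + (\<Sum>j<?m. K * \<mu> ^ (n - j))"
    if n: "?m \<le> n" for n
  proof -
    define A where "A = {x. window g x 0 n \<in> {ts. emits bs ts}}"
    define D where "D j = {x. window g x j (n - j) \<in> {ts. outs (run ts) = []}}" for j
    have ev: "A \<in> events" "D j \<in> events" for j
      unfolding A_def D_def sets_bernoulli by (rule sets_window)+
    have "prob {x. window id (factor g x) 0 ?m = bs} \<le> prob (A \<union> (\<Union>j<?m. D j))"
    proof (rule finite_measure_mono)
      show "{x. window id (factor g x) 0 ?m = bs} \<subseteq> A \<union> (\<Union>j<?m. D j)"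
        using emits_factor[OF n, of g _ 0] by (auto simp: A_def D_def)
    qed (use ev in auto)
    also have "\<dots> \<le> prob A + prob (\<Union>j<?m. D j)"
      by (intro measure_Un_le ev sets.finite_UN) auto
    also have "\<dots> \<le> prob A + (\<Sum>j<?m. prob (D j))"
      by (intro add_left_mono finite_measure_subadditive_finite) (use ev in auto)
    also have "\<dots> \<le> pr \<alpha> bs + (\<Sum>j<?m. K * \<mu> ^ (n - j))"
    proof (intro add_mono sum_mono)
      show "prob A \<le> pr \<alpha> bs"
        unfolding A_def measure_window using expect_emits_le[OF n] good[of 0] by (simp add: good_law_def)
      show "prob (D j) \<le> K * \<mu> ^ (n - j)" for j
        unfolding D_def measure_window using starve[OF good] by simp
    qed
    finally show ?thesis .
  qed
  then show "\<exists>N. \<forall>n\<ge>N. prob {x. window id (factor g x) 0 ?m = bs} \<le> pr \<alpha> bs + (\<Sum>j<?m. K * \<mu> ^ (n - j))"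
    by blast
qed

text \<open>The word probabilities on both sides sum to 1 for each length, so none of the assumed
  bounds can be strict.\<close>

lemma distr_factor:
  fixes p :: "nat \<Rightarrow> 'a pmf" and g :: "'a \<Rightarrow> bool option"
  assumes "\<And>bs. measure (bernoulli_measure p) {x. window id (factor g x) 0 (length bs) = bs} \<le> pr \<alpha> bs"
  shows "distr (bernoulli_measure p) seq_space (factor g) = bernoulli_measure (\<lambda>_. bernoulli_pmf \<alpha>)"
proof -
  interpret prob_space "bernoulli_measure p" by (rule prob_space_bernoulli)
  have meas: "factor g \<in> bernoulli_measure p \<rightarrow>\<^sub>M seq_space"
    using measurable_factor[of g] by (simp cong: measurable_cong_sets add: sets_bernoulli)
  let ?D = "distr (bernoulli_measure p) seq_space (factor g)"
  interpret D: prob_space ?D by (rule prob_space_distr[OF meas])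
  have D: "measure ?D {x. window id x 0 (length bs) = bs} =
      measure (bernoulli_measure p) {x. window id (factor g x) 0 (length bs) = bs}" for bs
    using sets_window[of id 0 "length bs" "{bs}"] by (subst measure_distr[OF meas]) (auto simp: vimage_def)
  have "measure ?D {x. window id x 0 (length bs) = bs} = pr \<alpha> bs" for bs
  proof (rule ccontr)
    let ?f = "\<lambda>bs. measure ?D {x. window id x 0 (length bs) = bs}"
    assume "?f bs \<noteq> pr \<alpha> bs"
    then have less: "?f bs < pr \<alpha> bs"
      using assms[of bs] D[of bs] by simp
    have "1 = measure ?D {x. window id x 0 (length bs) \<in> UNIV}"
      using D.prob_space by simp
    also have "\<dots> = (\<Sum>cs | length cs = length bs. measure ?D {x. window id x 0 (length bs) = cs})"
      by (subst measure_window_eq_sum[OF D.prob_space_axioms]) auto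
    also have "\<dots> = (\<Sum>cs | length cs = length bs. ?f cs)"
      by (intro sum.cong) auto
    also have "\<dots> < (\<Sum>cs | length cs = length bs. pr \<alpha> cs)"
    proof (rule sum_strict_mono_ex1)
      show "\<forall>cs\<in>{cs. length cs = length bs}. ?f cs \<le> pr \<alpha> cs"
        using assms unfolding D by blast
      show "\<exists>cs\<in>{cs. length cs = length bs}. ?f cs < pr \<alpha> cs"
        using less by blast
    qed simp
    also have "\<dots> = 1" by (rule sum_pr)
    finally show False by simp
  qed
  moreover have "measure (bernoulli_measure (\<lambda>_. bernoulli_pmf \<alpha>)) {x. window id x 0 (length bs) = bs} = pr \<alpha> bs" for bs
  proof -
    have "expect n (\<lambda>j. bernoulli_pmf \<alpha>) (\<lambda>ts. of_bool (ts = bs)) = of_bool (n = length bs) * pr \<alpha> bs" for n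
    proof (induction bs arbitrary: n)
      case Nil
      then show ?case by (cases n) auto
    next
      case (Cons b bs)
      then show ?case using \<alpha> by (cases n; cases b) (auto simp: UNIV_bool)
    qed
    then show ?thesis
      using measure_window[of "\<lambda>_. bernoulli_pmf \<alpha>" id 0 "length bs" "{bs}"] by (simp add: pmf.map_id)
  qed
  ultimately show ?thesis
    by (intro bernoulli_eqI D.prob_space_axioms) auto
qed

end

section \<open>Choice of parameters and conclusion\<close>

lemma exists_parameters:
  fixes q \<delta> :: real
  assumes q: "0 < q" "q < 1" and \<delta>: "0 < \<delta>" "\<delta> \<le> 1"
  obtains r J M T :: nat and z :: real
  where "r < J" "0 < M" "T = 2 * J * J" "0 < z" "z \<le> 1"
    "((1 / z) ^ r + q ^ r * (1 / z) ^ T) * z ^ M < 1"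
    "(1 - \<delta> * q / 4) ^ J * (1 / (1 - q / 2)) ^ M \<le> 1 / 2"
proof -
  define c where "c = - ln q"
  define a where "a = - ln (1 - \<delta> * q / 4)"
  define b where "b = - ln (1 - q / 2)"
  have dq: "0 < \<delta> * q" "\<delta> * q \<le> 1"
    using q \<delta> by (auto intro: mult_le_one)
  have c: "0 < c" "q ^ n = exp (- c * n)" for n
    using q by (auto simp: c_def ln_less_zero exp_of_nat2_mult[symmetric] powr_realpow[symmetric] powr_def)
  have a: "0 < a" "(1 - \<delta> * q / 4) ^ n = exp (- a * n)" for n
    using dq by (auto simp: a_def ln_less_zero powr_realpow[symmetric] powr_def)
  have b: "0 < b" "(1 / (1 - q / 2)) ^ n = exp (b * n)" for n
    using q by (auto simp: b_def ln_less_zero powr_realpow[symmetric] powr_def ln_div)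
  \<comment> \<open>With \<open>M = 2 * r\<close> a cycle with an ordinary read has a surplus of
    \<open>r\<close> coins. This gains a term of order \<open>1 / r ^ 3\<close>, while the rare deep
    reads cost only \<open>exp 1 * q ^ r\<close>.\<close>
  have "eventually (\<lambda>r::nat. exp (- 1 / (2 * real r ^ 3)) + exp 1 * exp (- c * r) < 1) at_top"
    using c(1) by real_asymp
  \<comment> \<open>A read pushes \<open>r ^ 2\<close> bits, whereas the storing phase has length
    \<open>2 * r\<close>.\<close>
  moreover have "eventually (\<lambda>r::nat. exp (- a * real r ^ 2 + b * (2 * real r)) \<le> 1 / 2) at_top"
    using a(1) b(1) by real_asymp
  moreover have "eventually (\<lambda>r::nat. 2 \<le> r) at_top"
    by (rule eventually_ge_at_top)
  ultimately have "eventually (\<lambda>r::nat. exp (- 1 / (2 * real r ^ 3)) + exp 1 * exp (- c * r) < 1 \<and>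
    exp (- a * real r ^ 2 + b * (2 * real r)) \<le> 1 / 2 \<and> 2 \<le> r) at_top"
    by eventually_elim simp
  then obtain r :: nat where r: "exp (- 1 / (2 * real r ^ 3)) + exp 1 * exp (- c * r) < 1"
    "exp (- a * real r ^ 2 + b * (2 * real r)) \<le> 1 / 2" "2 \<le> r"
    using eventually_happens'[OF sequentially_bot] by blast
  define J where "J = r ^ 2"
  define T where "T = 2 * J * J"
  \<comment> \<open>This scale makes a read of \<open>T\<close> coins cost the constant factor
    \<open>exp 1\<close>.\<close>
  define z where "z = exp (- 1 / real T)"
  have T: "real T = 2 * real r ^ 4" "0 < T"
    using r by (auto simp: T_def J_def power_mult_distrib simp flip: power_add)
  show ?thesis
  proof (rule that[of r J "2 * r" T z])
    show "r < J"
      using r by (simp add: J_def power2_eq_square)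
    show "0 < 2 * r" using r by simp
    show "0 < z" "z \<le> 1" by (auto simp: z_def)
    have zT: "(1 / z) ^ T = exp 1"
      using T(2) by (simp add: z_def exp_minus field_simps flip: exp_of_nat_mult)
    have zr: "z ^ r = exp (- 1 / (2 * real r ^ 3))"
    proof -
      have "real r * (- 1 / real T) = - 1 / (2 * real r ^ 3)"
        using r(3) by (simp add: T(1) field_simps eval_nat_numeral)
      then show ?thesis
        by (simp add: z_def flip: exp_of_nat_mult)
    qed
    have "((1 / z) ^ r + q ^ r * (1 / z) ^ T) * z ^ (2 * r) = z ^ r + q ^ r * (1 / z) ^ T * z ^ (2 * r)"
      using \<open>0 < z\<close> by (simp add: distrib_right power_divide power_add mult_2)
    also have "\<dots> \<le> z ^ r + q ^ r * (1 / z) ^ T * 1"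
      using q \<open>0 < z\<close> \<open>z \<le> 1\<close> by (intro add_left_mono mult_left_mono power_le_one) auto
    also have "\<dots> < 1"
      using r(1) unfolding zT zr c(2) by (simp add: mult.commute)
    finally show "((1 / z) ^ r + q ^ r * (1 / z) ^ T) * z ^ (2 * r) < 1" .
    have "(1 - \<delta> * q / 4) ^ J * (1 / (1 - q / 2)) ^ (2 * r) = exp (- a * real r ^ 2 + b * (2 * real r))"
      unfolding a(2) b(2) J_def by (simp add: exp_add[symmetric])
    then show "(1 - \<delta> * q / 4) ^ J * (1 / (1 - q / 2)) ^ (2 * r) \<le> 1 / 2"
      using r by simp
  qed (simp add: T_def)
qed

lemma entropy_pos_imp_nontrivial:
  assumes "shannon_entropy \<rho> > 0"
  obtains c where "0 < pmf \<rho> c" "pmf \<rho> c < 1"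
proof (rule ccontr)
  assume "\<not> thesis"
  then have "pmf \<rho> c = 0 \<or> pmf \<rho> c = 1" for c
    using that[of c] pmf_nonneg[of \<rho> c] pmf_le_1[of \<rho> c]
    by (cases "0 < pmf \<rho> c"; cases "pmf \<rho> c < 1") auto
  then have "pmf \<rho> c * ln (pmf \<rho> c) = 0" for c
    by (metis ln_one mult_eq_0_iff)
  then have "(\<Sum>c\<in>UNIV. pmf \<rho> c * ln (pmf \<rho> c)) = 0"
    by (intro sum.neutral) blast
  then show False
    using assms by (simp add: shannon_entropy_def)
qed

lemma prob_eq_pmf_cond:
  assumes "measure_pmf.prob p E > 0" "c \<in> E"
  shows "pmf p c = measure_pmf.prob p E * pmf (cond_pmf p E) c"
proof -
  have "set_pmf p \<inter> E \<noteq> {}"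
    using assms(1) measure_Int_set_pmf[of p E] by (metis Int_commute less_irrefl measure_empty)
  then show ?thesis
    using assms by (simp add: pmf_cond)
qed

theorem theorem7:
  fixes E :: "'a::finite set" and \<rho> :: "'a pmf" and \<delta> :: real
  assumes "card E \<ge> 2"
    and "set_pmf \<rho> \<subseteq> E"
    and "shannon_entropy \<rho> > 0"
    and "\<delta> > 0"
  shows "\<exists>\<phi> :: (nat \<Rightarrow> 'a) \<Rightarrow> (nat \<Rightarrow> bool).
    \<phi> \<in> seq_space \<rightarrow>\<^sub>M seq_space \<and>
    (\<forall>p :: nat \<Rightarrow> 'a pmf.
       (\<forall>n. measure_pmf.prob (p n) E \<ge> \<delta>) \<longrightarrow>
       (\<forall>n. cond_pmf (p n) E = \<rho>) \<longrightarrow>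
       nonsingular (bernoulli_measure p) left_shift \<longrightarrow>
       (\<exists>\<alpha> :: bool pmf. pmf \<alpha> False > 0 \<and> pmf \<alpha> True > 0 \<and>
          measure_preserving_factor \<phi>
            (bernoulli_measure p) left_shift
            (bernoulli_measure (\<lambda>n. \<alpha>)) left_shift))"
proof -
  obtain c where c: "0 < pmf \<rho> c" "pmf \<rho> c < 1"
    using entropy_pos_imp_nontrivial[OF assms(3)] .
  then have "c \<in> E"
    using assms(2) by (auto simp: set_pmf_iff)
  define q where "q = pmf \<rho> c"
  \<comment> \<open>The rate estimates take a density at most 1; being a lower bound for
    \<open>p n\<close> on \<open>E\<close> passes from \<open>\<delta>\<close> to
    \<open>d\<close>.\<close>
  define d where "d = min \<delta> 1"
  have d: "0 < d" "d \<le> 1" and q: "0 < q" "q < 1"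
    using assms(4) c by (auto simp: d_def q_def)
  obtain r J M T :: nat and z :: real where par: "r < J" "0 < M" "T = 2 * J * J" and z: "0 < z" "z \<le> 1"
    and gain: "((1 / z) ^ r + q ^ r * (1 / z) ^ T) * z ^ M < 1"
      "(1 - d * q / 4) ^ J * (1 / (1 - q / 2)) ^ M \<le> 1 / 2"
    by (rule exists_parameters[OF q d])
  interpret block_code q r J
    using q par by unfold_locales
  interpret stack_coding q bias r J M T "short_leaves \<union> long_leaves" leaf_value
    using stack_coding[OF par(2)] par(3) by simp
  obtain \<mu> K where \<mu>: "0 < \<mu>" "\<mu> < 1"
    "\<forall>n P. good_law d P \<longrightarrow> expect n P (\<lambda>ts. of_bool (outs (run ts) = [])) \<le> K * \<mu> ^ n"
    by (rule expect_no_output[OF d z gain])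
  define g where "g a = (if a \<in> E then Some (a = c) else None)" for a
  show ?thesis
  \<comment> \<open>The map is built from \<open>E\<close>, \<open>c\<close>, \<open>\<rho>\<close>
    and \<open>\<delta>\<close> before \<open>p\<close> is introduced, so it serves all admissible
    \<open>p\<close> at once.\<close>
  proof (intro exI[of _ "factor g"] conjI allI impI measurable_factor)
    fix p :: "nat \<Rightarrow> 'a pmf"
    assume pE: "\<forall>n. measure_pmf.prob (p n) E \<ge> \<delta>" and \<rho>: "\<forall>n. cond_pmf (p n) E = \<rho>"
    have law: "coin_law (map_pmf g (p n)) \<and> d \<le> 1 - pmf (map_pmf g (p n)) None" for n
    proof -
      have pos: "measure_pmf.prob (p n) E > 0"
        using pE assms(4) by (metis less_le_trans)
      have "g -` {Some True} = {c}" "g -` {None} = - E"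
        using \<open>c \<in> E\<close> by (auto simp: g_def split: if_splits)
      \<comment> \<open>Given that the letter is in \<open>E\<close>, it is \<open>c\<close> with
        probability \<open>q\<close> for every \<open>n\<close>; only the mass of \<open>E\<close>
        varies.\<close>
      then have T: "pmf (map_pmf g (p n)) (Some True) = measure_pmf.prob (p n) E * q"
        and N: "pmf (map_pmf g (p n)) None = 1 - measure_pmf.prob (p n) E"
        using prob_eq_pmf_cond[OF pos \<open>c \<in> E\<close>] \<rho> measure_pmf.prob_compl[of E "p n"]
        by (auto simp: pmf_map q_def measure_pmf_single Compl_eq_Diff_UNIV)
      have "(\<Sum>t\<in>UNIV. pmf (map_pmf g (p n)) t) = 1"
        by (rule sum_pmf_eq_1) auto
      then have "pmf (map_pmf g (p n)) None + (pmf (map_pmf g (p n)) (Some True) + pmf (map_pmf g (p n)) (Some False)) = 1"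
        by (simp add: UNIV_option_conv UNIV_bool add.commute)
      with T N have "pmf (map_pmf g (p n)) (Some False) = measure_pmf.prob (p n) E * (1 - q)"
        by (simp add: algebra_simps)
      with T N pE show ?thesis
        by (simp add: coin_law_def d_def min.coboundedI1)
    qed
    have good: "good_law d (\<lambda>j. map_pmf g (p (i + j)))" for i
      using law by (simp add: good_law_def)
    have "measure_preserving_factor (factor g) (bernoulli_measure p) left_shift
      (bernoulli_measure (\<lambda>n. bernoulli_pmf bias)) left_shift"
      unfolding measure_preserving_factor_def
    proof (intro conjI ballI factor_left_shift)
      show "factor g \<in> bernoulli_measure p \<rightarrow>\<^sub>M bernoulli_measure (\<lambda>n. bernoulli_pmf bias)"
        using measurable_factor[of g] by (simp cong: measurable_cong_sets add: sets_bernoulli)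
      have "distr (bernoulli_measure p) (bernoulli_measure (\<lambda>n. bernoulli_pmf bias)) (factor g) =
        distr (bernoulli_measure p) seq_space (factor g)"
        by (intro distr_cong refl sets_bernoulli)
      then show "distr (bernoulli_measure p) (bernoulli_measure (\<lambda>n. bernoulli_pmf bias)) (factor g) =
        bernoulli_measure (\<lambda>n. bernoulli_pmf bias)"
        using distr_factor[OF measure_factor_le[OF good \<mu>(1,2) \<mu>(3)[rule_format]]] by simp
    qed
    then show "\<exists>\<alpha> :: bool pmf. pmf \<alpha> False > 0 \<and> pmf \<alpha> True > 0 \<and>
      measure_preserving_factor (factor g) (bernoulli_measure p) left_shift (bernoulli_measure (\<lambda>n. \<alpha>)) left_shift"
      using bias by (intro exI[of _ "bernoulli_pmf bias"]) auto
  qed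
qed

end
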